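(* Let $d\ge1$ and let $f\in R=\mathbb{C}[x_1,\ldots,x_d]$ be nonzero. The principal ideal $(f)\subseteq R$ is a power-closed ideal if and only if $$f=\tilde{x}^{\tilde p}\prod_{i=1}^k f_i(\tilde{\xi}_i)$$ for some monomial $\tilde{x}^{\tilde p}\in R$, where the $\tilde{\xi}_i$ are distinct positive fractions of primitive pairs of monomials, for some term order on $[x_1,\ldots,x_d]$, and where each $f_i\in\mathbb{C}[x]$ is a nonzero power-polynomial, and therefore, up to multiplication by a unit of $\mathbb{C}[x^{\pm1}]$, is a product $\prod_{n\ge1}\phi_n(x)^{a_n}$ of cyclotomic polynomials with $a_m\ge a_n$ whenever $m\mid n$, and also is a product of psi-polynomials.
   Context: For $f\in R$ (and similarly in one variable) and $i\in\mathbb{N}=\{1,2,\ldots\}$, $f^{(i)}=f(x_1^i,\ldots,x_d^i)$. An ideal $I$ of $R$ is power-closed if $f\in I$ implies $f^{(i)}\in I$ for every $i\in\mathbb{N}$. A polynomial $g\in\mathbb{C}[x]$ is a power-polynomial if $g(x)$ divides $g(x^i)$ for every $i\in\mathbb{N}$. The displayed identity is to be read in $\mathbb{C}[x_1^{\pm1},\ldots,x_d^{\pm1}]\supseteq R$. $[x_1,\ldots,x_d]$ is the multiplicative monoid of monomials $\tilde{x}^{\tilde{p}}=x_1^{p_1}\cdots x_d^{p_d}$, $\tilde p\in\mathbb{Z}_{\ge0}^d$; a term order is a total well-order on it compatible with multiplication and having $1$ as least element. A pair $\tilde p,\tilde q$ of $d$-tuples of nonnegative integers is primitive if their supports $\{i:p_i\ne0\}$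 and $\{i:q_i\neq 0\}$ are disjoint and the greatest common divisor of all coordinates of $\tilde p$ and $\tilde q$ together is $1$. A positive fraction of a primitive pair of monomials (with respect to a given term order) is an element $\tilde\xi=\tilde{x}^{\tilde q}/\tilde{x}^{\tilde p}$ of $\mathbb{C}[x_1^{\pm1},\ldots,x_d^{\pm1}]$ with $\tilde p,\tilde q$ primitive and $\tilde{x}^{\tilde q}>\tilde{x}^{\tilde p}$. $\phi_n$ is the $n$-th cyclotomic polynomial. A psi-polynomial is a polynomial of the form $\psi_A(x)=\mathrm{lcm}(x^a-1:a\in A)$, where $A$ is a finite antichain of $\mathbb{N}$ ordered by divisibility. *)

theory Defs
  imports
    Complex_Main
    "HOL-Library.Poly_Mapping"
    "HOL-Computational_Algebra.Polynomial_Factorial"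
    "HOL-Computational_Algebra.Field_as_Ring"
begin

text \<open>The variables \<open>x\<^sub>1, \<dots>, x\<^sub>d\<close> are indexed by an arbitrary finite type \<open>'n\<close>, so \<open>d = CARD('n) \<ge> 1\<close>.
  An exponent tuple stands for its monomial; multiplication of monomials is addition of exponents.\<close>

type_synonym 'n exponent = "'n \<Rightarrow>\<^sub>0 nat"
type_synonym 'n mpoly = "'n exponent \<Rightarrow>\<^sub>0 complex"
type_synonym 'n laurent = "('n \<Rightarrow>\<^sub>0 int) \<Rightarrow>\<^sub>0 complex"
type_synonym laurent1 = "int \<Rightarrow>\<^sub>0 complex"

abbreviation const :: "complex \<Rightarrow> 'k::comm_monoid_add \<Rightarrow>\<^sub>0 complex" where
  "const \<equiv> Poly_Mapping.single 0"


subsection \<open>Substitution and the inclusions into Laurent polynomials\<close>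

definition subst :: "('n::finite \<Rightarrow> ('k::comm_monoid_add \<Rightarrow>\<^sub>0 complex)) \<Rightarrow> 'n mpoly \<Rightarrow> ('k \<Rightarrow>\<^sub>0 complex)" where
  "subst v f = (\<Sum>p\<in>Poly_Mapping.keys f.
     const (Poly_Mapping.lookup f p) * (\<Prod>j\<in>UNIV. v j ^ Poly_Mapping.lookup p j))"

definition mvar :: "'n \<Rightarrow> 'n mpoly" where
  "mvar j = Poly_Mapping.single (Poly_Mapping.single j 1) 1"

definition lvar :: "'n \<Rightarrow> 'n laurent" where
  "lvar j = Poly_Mapping.single (Poly_Mapping.single j 1) 1"

definition to_laurent :: "'n::finite mpoly \<Rightarrow> 'n laurent" where
  "to_laurent = subst lvar"

definition eval_at :: "('k::comm_monoid_add \<Rightarrow>\<^sub>0 complex) \<Rightarrow> complex poly \<Rightarrow> ('k \<Rightarrow>\<^sub>0 complex)" where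
  "eval_at \<xi> g = poly (map_poly const g) \<xi>"

definition to_laurent1 :: "complex poly \<Rightarrow> laurent1" where
  "to_laurent1 = eval_at (Poly_Mapping.single 1 1)"

text \<open>Equality up to multiplication by a unit of \<open>\<complex>[x\<^sup>\<plusminus>\<^sup>1]\<close>.\<close>

definition laurent_associated :: "complex poly \<Rightarrow> complex poly \<Rightarrow> bool" where
  "laurent_associated g h \<longleftrightarrow> (\<exists>u::laurent1. u dvd 1 \<and> to_laurent1 g = u * to_laurent1 h)"


subsection \<open>Power-closed ideals and power-polynomials\<close>

definition power_subst :: "nat \<Rightarrow> 'n::finite mpoly \<Rightarrow> 'n mpoly" where
  "power_subst i = subst (\<lambda>j. mvar j ^ i)"

definition is_ideal :: "'a::comm_ring_1 set \<Rightarrow> bool" where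
  "is_ideal I \<longleftrightarrow> 0 \<in> I \<and> (\<forall>a\<in>I. \<forall>b\<in>I. a + b \<in> I) \<and> (\<forall>a\<in>I. \<forall>r. r * a \<in> I)"

definition principal_ideal :: "'a::comm_ring_1 \<Rightarrow> 'a set" where
  "principal_ideal a = {r * a | r. True}"

definition power_closed_ideal :: "'n::finite mpoly set \<Rightarrow> bool" where
  "power_closed_ideal I \<longleftrightarrow> is_ideal I \<and> (\<forall>f\<in>I. \<forall>i\<ge>1. power_subst i f \<in> I)"

definition power_polynomial :: "complex poly \<Rightarrow> bool" where
  "power_polynomial g \<longleftrightarrow> (\<forall>i\<ge>1. g dvd pcompose g (monom 1 i))"


subsection \<open>Term orders and positive fractions\<close>

text \<open>A relation \<open>T\<close> with \<open>(p, q) \<in> T\<close> meaning \<open>x\<^sup>p \<le> x\<^sup>q\<close>.\<close>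

definition term_order :: "'n exponent rel \<Rightarrow> bool" where
  "term_order T \<longleftrightarrow> well_order_on UNIV T
     \<and> (\<forall>p q s. (p, q) \<in> T \<longrightarrow> (p + s, q + s) \<in> T)
     \<and> (\<forall>p. (0, p) \<in> T)"

definition primitive_pair :: "'n exponent \<Rightarrow> 'n exponent \<Rightarrow> bool" where
  "primitive_pair p q \<longleftrightarrow> Poly_Mapping.keys p \<inter> Poly_Mapping.keys q = {}
     \<and> Gcd (range (Poly_Mapping.lookup p) \<union> range (Poly_Mapping.lookup q)) = 1"

text \<open>The Laurent monomial \<open>x\<^sup>q / x\<^sup>p\<close>, whose exponent is \<open>q - p\<close>.\<close>

definition fraction :: "'n exponent \<Rightarrow> 'n exponent \<Rightarrow> 'n laurent" where
  "fraction q p = Poly_Mapping.single (Poly_Mapping.map int q - Poly_Mapping.map int p) 1"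

definition positive_fraction :: "'n exponent rel \<Rightarrow> 'n laurent \<Rightarrow> bool" where
  "positive_fraction T \<xi> \<longleftrightarrow>
     (\<exists>p q. primitive_pair p q \<and> (p, q) \<in> T \<and> p \<noteq> q \<and> \<xi> = fraction q p)"


subsection \<open>Cyclotomic polynomials and psi-polynomials\<close>

definition cyclotomic :: "nat \<Rightarrow> complex poly" where
  "cyclotomic n = (\<Prod>z\<in>{z. z ^ n = 1 \<and> (\<forall>m. 0 < m \<and> m < n \<longrightarrow> z ^ m \<noteq> 1)}. [:- z, 1:])"

definition divisibility_antichain :: "nat set \<Rightarrow> bool" where
  "divisibility_antichain A \<longleftrightarrow> 0 \<notin> A \<and> (\<forall>a\<in>A. \<forall>b\<in>A. a dvd b \<longrightarrow> a = b)"

text \<open>On \<open>complex poly\<close>, \<open>Lcm\<close> is normalised to be monic.\<close>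

definition psi :: "nat set \<Rightarrow> complex poly" where
  "psi A = Lcm ((\<lambda>a. monom 1 a - 1) ` A)"

end

theory Submission
  imports Defs "HOL-Computational_Algebra.Fundamental_Theorem_Algebra"
begin

text \<open>
  Write \<open>L\<close> for the ring of Laurent polynomials, \<open>x^u\<close> for the monomial with exponent \<open>u \<in> \<int>^d\<close> and
  \<open>F^(m)\<close> for the result of replacing every variable in \<open>F\<close> by its \<open>m\<close>-th power.  The ideal \<open>(f)\<close> is
  power-closed iff \<open>f\<close> divides every \<open>f^(m)\<close>, and for this divisibility it does not matter whether it
  is taken in \<open>R\<close> or in \<open>L\<close>: a lexicographic order starting with the variable \<open>x_j\<close> shows that the
  quotient has no negative power of \<open>x_j\<close> (\<open>dvd_power_subst_iff\<close>).  If \<open>f\<close> is a product of a monomial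
  and of power-polynomials at monomials, the divisibility holds factor by factor.

  For the converse, let \<open>f = \<Sum> c_u x^u\<close> and let \<open>f\<close> divide all \<open>f^(m) = \<Sum> c_u (x^u)^m\<close> with \<open>m \<ge> 1\<close>.
  By linearity \<open>f\<close> divides \<open>\<Sum> c_u x^u h(x^u)\<close> for every \<open>h \<in> L[t]\<close>.  Choosing for \<open>h\<close> the polynomial
  that vanishes at all \<open>x^u\<close> in the support of \<open>f\<close> except \<open>x^(u0)\<close>, one finds that \<open>f\<close> divides a product
  of differences \<open>x^(u0) - x^u\<close> (\<open>dvd_prod_support_differences\<close>).  Each difference is a unit times
  \<open>\<xi>^n - 1 = \<Prod> (\<xi> - \<zeta>)\<close>, where \<open>\<xi> = x^v\<close> with a primitive vector \<open>v\<close> and \<open>\<zeta>\<close> runs through the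
  \<open>n\<close>-th roots of unity.

  The elements \<open>x^v - \<zeta>\<close> are prime in \<open>L\<close> (\<open>prime_X_minus_const\<close>): choose \<open>w\<close> with \<open>w \<cdot> v = 1\<close>, so that
  \<open>\<int>^d = \<int>v \<oplus> ker w\<close>; then reduction modulo \<open>x^v - \<zeta>\<close> is the endomorphism of the domain \<open>L\<close> that puts
  \<open>x^v = \<zeta>\<close> and fixes \<open>x^u\<close> for \<open>u \<in> ker w\<close>.  Hence \<open>f\<close> is a unit of \<open>L\<close>, that is, a monomial \<open>c x^t\<close>,
  times a product of such primes.  If every \<open>v\<close> is chosen positive for a lexicographic term order, the
  least monomial of \<open>f\<close> is \<open>x^t\<close>, so \<open>x^t \<in> R\<close>.  Collecting the primes with the same \<open>v\<close> into
  \<open>g_v(x^v)\<close>, the prime factors belonging to different positive \<open>v\<close> are not associated, so the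
  divisibility \<open>f | f^(m)\<close> splits into the divisibilities \<open>g_v(x) | g_v(x^m)\<close>
  (\<open>factor_at_power_polynomial\<close>).

  In one variable, \<open>g(x) | g(x^i)\<close> says that the multiplicity of a root \<open>\<zeta> \<noteq> 0\<close> in \<open>g\<close> is at most that of
  \<open>\<zeta>^i\<close> (\<open>order_le_order_power\<close>).  So the powers of \<open>\<zeta>\<close> are again roots, \<open>\<zeta>\<close> is a root of unity, and the
  multiplicity \<open>a_n\<close> of a primitive \<open>n\<close>-th root of unity depends only on \<open>n\<close> and can only grow when \<open>n\<close>
  is replaced by a divisor.  The sets \<open>{n. a_n \<ge> j}\<close> are then closed under divisors; the psi-polynomial
  of the maximal elements of the \<open>j\<close>-th set is the product of its \<open>\<phi>_n\<close>, and the product of these over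
  \<open>j\<close> is \<open>\<Prod> \<phi>_n^(a_n)\<close>.
\<close>

section \<open>Extending characters of monoids to monoid algebras\<close>

abbreviation X :: "'k \<Rightarrow> ('k::comm_monoid_add \<Rightarrow>\<^sub>0 complex)" where
  "X u \<equiv> Poly_Mapping.single u 1"

text \<open>Every homomorphism between the polynomial rings below (inclusion into Laurent polynomials, substitution
  of powers, specialization) is determined by its values \<open>\<chi> u\<close> on monomials and is the linear extension
  of \<open>\<chi>\<close>.  It is multiplicative as soon as \<open>\<chi>\<close> is a character of the exponent monoid.\<close>

definition extend :: "('a \<Rightarrow> ('b::comm_monoid_add \<Rightarrow>\<^sub>0 complex)) \<Rightarrow> ('a \<Rightarrow>\<^sub>0 complex) \<Rightarrow> ('b \<Rightarrow>\<^sub>0 complex)" where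
  "extend \<chi> F = (\<Sum>u\<in>Poly_Mapping.keys F. const (Poly_Mapping.lookup F u) * \<chi> u)"

lemma const_mult: "const (a * b) = const a * const b"
  by (simp add: mult_single)

lemma const_power: "const (a ^ n) = const a ^ n"
  by (induction n) (simp_all add: const_mult)

lemma extend_superset:
  assumes "finite A" "Poly_Mapping.keys F \<subseteq> A"
  shows "extend \<chi> F = (\<Sum>u\<in>A. const (Poly_Mapping.lookup F u) * \<chi> u)"
  unfolding extend_def
  by (rule sum.mono_neutral_left) (use assms in \<open>auto simp: in_keys_iff\<close>)

lemma extend_add: "extend \<chi> (F + G) = extend \<chi> F + extend \<chi> G"
proof -
  let ?A = "Poly_Mapping.keys F \<union> Poly_Mapping.keys G"
  have "extend \<chi> (F + G) = (\<Sum>u\<in>?A. const (Poly_Mapping.lookup (F + G) u) * \<chi> u)"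
    by (rule extend_superset) (auto simp: keys_add)
  also have "\<dots> = (\<Sum>u\<in>?A. const (Poly_Mapping.lookup F u) * \<chi> u)
      + (\<Sum>u\<in>?A. const (Poly_Mapping.lookup G u) * \<chi> u)"
    by (simp add: lookup_add single_add distrib_right sum.distrib)
  also have "\<dots> = extend \<chi> F + extend \<chi> G"
    by (simp add: extend_superset[of ?A])
  finally show ?thesis .
qed

lemma extend_0 [simp]: "extend \<chi> 0 = 0"
  by (simp add: extend_def)

lemma extend_sum: "extend \<chi> (\<Sum>i\<in>I. F i) = (\<Sum>i\<in>I. extend \<chi> (F i))"
  by (induction I rule: infinite_finite_induct) (auto simp: extend_add)

lemma extend_single: "extend \<chi> (Poly_Mapping.single u c) = const c * \<chi> u"
  by (cases "c = 0") (simp_all add: extend_def)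

lemma extend_uminus: "extend \<chi> (- F) = - extend \<chi> F"
  using extend_add[of \<chi> "F" "-F"] by (simp add: eq_neg_iff_add_eq_0 add.commute)

lemma extend_diff: "extend \<chi> (F - G) = extend \<chi> F - extend \<chi> G"
  using extend_add[of \<chi> F "-G"] by (simp add: extend_uminus)

lemma monomial_expansion: "F = (\<Sum>u\<in>Poly_Mapping.keys F. Poly_Mapping.single u (Poly_Mapping.lookup F u))"
  by (rule poly_mapping_eqI)
     (auto simp: lookup_sum lookup_single when_def in_keys_iff)

lemma mult_expansion:
  "F * G = (\<Sum>u\<in>Poly_Mapping.keys F. \<Sum>v\<in>Poly_Mapping.keys G.
     Poly_Mapping.single (u + v) (Poly_Mapping.lookup F u * Poly_Mapping.lookup G v))"
  by (subst monomial_expansion[of F], subst monomial_expansion[of G])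
     (simp add: sum_product mult_single)

locale monoid_character =
  fixes \<chi> :: "'a::comm_monoid_add \<Rightarrow> ('b::comm_monoid_add \<Rightarrow>\<^sub>0 complex)"
  assumes char_0: "\<chi> 0 = 1" and char_add: "\<chi> (u + v) = \<chi> u * \<chi> v"
begin

lemma extend_1 [simp]: "extend \<chi> 1 = 1"
  using extend_single[of \<chi> 0 1] by (simp add: char_0)

lemma extend_const: "extend \<chi> (const c) = const c"
  by (simp add: extend_single char_0)

lemma extend_mult: "extend \<chi> (F * G) = extend \<chi> F * extend \<chi> G"
proof -
  have "extend \<chi> (F * G) = (\<Sum>u\<in>Poly_Mapping.keys F. \<Sum>v\<in>Poly_Mapping.keys G.
     const (Poly_Mapping.lookup F u * Poly_Mapping.lookup G v) * \<chi> (u + v))"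
    by (simp add: mult_expansion[of F G] extend_sum extend_single)
  also have "\<dots> = (\<Sum>u\<in>Poly_Mapping.keys F. \<Sum>v\<in>Poly_Mapping.keys G.
     (const (Poly_Mapping.lookup F u) * \<chi> u) * (const (Poly_Mapping.lookup G v) * \<chi> v))"
    by (simp add: char_add const_mult mult_ac)
  also have "\<dots> = extend \<chi> F * extend \<chi> G"
    by (simp add: extend_def sum_product)
  finally show ?thesis .
qed

lemma extend_prod: "extend \<chi> (\<Prod>i\<in>I. F i) = (\<Prod>i\<in>I. extend \<chi> (F i))"
  by (induction I rule: infinite_finite_induct) (auto simp: extend_mult)

end

lemma X_add: "X (u + v) = X u * (X v :: 'k::comm_monoid_add \<Rightarrow>\<^sub>0 complex)"
  by (simp add: mult_single)

lemma X_sum: "X (\<Sum>i\<in>I. u i) = (\<Prod>i\<in>I. X (u i) :: 'k::comm_monoid_add \<Rightarrow>\<^sub>0 complex)"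
  by (induction I rule: infinite_finite_induct) (auto simp: X_add)

lemma monoid_character_X:
  assumes "\<phi> 0 = 0" "\<And>u v. \<phi> (u + v) = \<phi> u + \<phi> v"
  shows "monoid_character (\<lambda>u. X (\<phi> u))"
  by unfold_locales (simp_all add: assms X_add)

lemma keys_extend_X: "Poly_Mapping.keys (extend (\<lambda>u. X (\<phi> u)) F) \<subseteq> \<phi> ` Poly_Mapping.keys F"
proof
  fix w assume "w \<in> Poly_Mapping.keys (extend (\<lambda>u. X (\<phi> u)) F)"
  then have "(\<Sum>u\<in>Poly_Mapping.keys F. Poly_Mapping.lookup F u when \<phi> u = w) \<noteq> 0"
    by (simp add: in_keys_iff extend_def lookup_sum mult_single lookup_single)
  then obtain u where "u \<in> Poly_Mapping.keys F" "(Poly_Mapping.lookup F u when \<phi> u = w) \<noteq> 0"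
    by (rule sum.not_neutral_contains_not_neutral)
  then show "w \<in> \<phi> ` Poly_Mapping.keys F" by (auto simp: when_def split: if_splits)
qed

lemma lookup_extend_X:
  assumes "inj \<phi>"
  shows "Poly_Mapping.lookup (extend (\<lambda>u. X (\<phi> u)) F) (\<phi> u) = Poly_Mapping.lookup F u"
proof -
  have "Poly_Mapping.lookup (extend (\<lambda>u. X (\<phi> u)) F) (\<phi> u)
      = (\<Sum>v\<in>Poly_Mapping.keys F. if v = u then Poly_Mapping.lookup F u else 0)"
    unfolding extend_def lookup_sum
    by (rule sum.cong) (use assms in \<open>auto simp: mult_single lookup_single when_def dest: injD\<close>)
  then show ?thesis by (simp add: in_keys_iff)
qed

lemma monomial_dvd_1:
  assumes "c \<noteq> 0"
  shows "Poly_Mapping.single u c dvd (1 :: 'k::ab_group_add \<Rightarrow>\<^sub>0 complex)"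
proof
  show "1 = Poly_Mapping.single u c * Poly_Mapping.single (- u) (1 / c)"
    using assms by (simp add: mult_single)
qed

lemma monomial_mult_dvd_iff:
  fixes F G :: "'n::finite laurent"
  assumes "c \<noteq> 0"
  shows "F dvd Poly_Mapping.single u c * G \<longleftrightarrow> F dvd G"
proof
  obtain w :: "'n laurent" where w: "1 = Poly_Mapping.single u c * w"
    using monomial_dvd_1[OF assms] by (rule dvdE)
  assume "F dvd Poly_Mapping.single u c * G"
  then have "F dvd w * (Poly_Mapping.single u c * G)" by (rule dvd_mult)
  also have "w * (Poly_Mapping.single u c * G) = (Poly_Mapping.single u c * w) * G" by (simp only: mult_ac)
  finally show "F dvd G" using w by simp
qed simp

lemma X_power_frag_cmul: "(X u :: ('n \<Rightarrow>\<^sub>0 int) \<Rightarrow>\<^sub>0 complex) ^ n = X (frag_cmul (int n) u)"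
proof (induction n)
  case (Suc n)
  have "frag_cmul (int (Suc n)) u = u + frag_cmul (int n) u"
    using frag_cmul_distrib[of 1 "int n" u] by simp
  with Suc show ?case by (simp add: X_add)
qed simp

section \<open>Evaluating polynomials in one variable\<close>

lemma eval_at_0 [simp]: "eval_at \<xi> 0 = 0"
  by (simp add: eval_at_def)

lemma eval_at_pCons: "eval_at \<xi> (pCons a g) = const a + \<xi> * eval_at \<xi> g"
  by (simp add: eval_at_def map_poly_pCons)

lemma eval_at_1 [simp]: "eval_at \<xi> 1 = 1"
  by (simp add: one_pCons eval_at_pCons)

lemma eval_at_add: "eval_at \<xi> (g + h) = eval_at \<xi> g + eval_at \<xi> h"
proof (induction g arbitrary: h)
  case (pCons a g)
  show ?case
  proof (cases h)
    case (pCons b h')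
    with pCons.IH show ?thesis
      by (simp add: eval_at_pCons single_add distrib_left)
  qed
qed simp

lemma eval_at_smult: "eval_at \<xi> (smult c g) = const c * eval_at \<xi> g"
proof (induction g)
  case (pCons a g)
  then show ?case by (simp add: eval_at_pCons const_mult distrib_left mult_ac)
qed simp

lemma eval_at_mult: "eval_at \<xi> (g * h) = eval_at \<xi> g * eval_at \<xi> h"
  by (induction g) (simp_all add: eval_at_pCons eval_at_add eval_at_smult algebra_simps)

lemma eval_at_prod_mset: "eval_at \<xi> (\<Prod>i\<in>#I. g i) = (\<Prod>i\<in>#I. eval_at \<xi> (g i))"
  by (induction I) (auto simp: eval_at_mult)

lemma eval_at_linear: "eval_at \<xi> [:- z, 1:] = \<xi> - const z"
  by (simp add: eval_at_pCons single_uminus)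

lemma eval_at_monom: "eval_at \<xi> (monom c n) = const c * \<xi> ^ n"
  by (induction n) (auto simp: monom_0 monom_Suc eval_at_pCons mult_ac)

lemma eval_at_pcompose: "eval_at \<xi> (pcompose g h) = eval_at (eval_at \<xi> h) g"
  by (induction g) (auto simp: pcompose_pCons eval_at_add eval_at_mult eval_at_pCons)

text \<open>Raising the point to the power \<open>m\<close> is the same as replacing \<open>g(x)\<close> by \<open>g(x^m)\<close>;
  this links power-polynomials to the map \<open>F \<mapsto> F^(m)\<close>.\<close>

lemma eval_at_substitute_power: "eval_at \<xi> (pcompose g (monom 1 m)) = eval_at (\<xi> ^ m) g"
  by (simp add: eval_at_pcompose eval_at_monom)

lemma eval_at_const: "eval_at (const c) g = const (poly g c)"
  by (induction g) (auto simp: eval_at_pCons mult_single single_add)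

lemma eval_at_dvd: "g dvd h \<Longrightarrow> eval_at \<xi> g dvd eval_at \<xi> h"
  by (auto simp: dvd_def eval_at_mult)

lemma (in monoid_character) extend_eval_at: "extend \<chi> (eval_at \<xi> g) = eval_at (extend \<chi> \<xi>) g"
  by (induction g) (auto simp: eval_at_pCons extend_add extend_mult extend_const)

lemma pcompose_monom_nonzero:
  fixes g :: "complex poly"
  assumes "g \<noteq> 0" "m \<ge> 1"
  shows "pcompose g (monom 1 m) \<noteq> 0"
  using pcompose_eq_0[of g "monom 1 m"] assms by (auto simp: degree_monom_eq)

lemma pcompose_power: "pcompose (p ^ n) r = pcompose p r ^ n"
  for p r :: "'a::comm_ring_1 poly"
  by (induction n) (simp_all add: pcompose_mult pcompose_1)

lemma eval_at_split:
  "eval_at \<xi> g = const (lead_coeff g) * (\<Prod>z\<in>#proots g. \<xi> - const z)"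
  by (subst complex_poly_decompose_multiset[of g, symmetric])
     (simp only: eval_at_smult eval_at_prod_mset eval_at_linear)

section \<open>Totally ordered exponents\<close>

text \<open>\<open>P\<close> is the positive cone of a total order on the group of exponents.  Such an order gives every nonzero
  Laurent polynomial an extremal monomial, and extremal monomials multiply.\<close>

locale total_group_order =
  fixes P :: "'a::ab_group_add \<Rightarrow> bool"
  assumes pos_add: "P u \<Longrightarrow> P v \<Longrightarrow> P (u + v)"
    and pos_total: "u \<noteq> 0 \<Longrightarrow> P u \<or> P (- u)"
    and not_pos_0: "\<not> P 0"
begin

text \<open>Reversing the order turns every fact about least keys into one about greatest keys.\<close>

lemma opposite_order: "total_group_order (\<lambda>u. P (- u))"
  by unfold_locales (use pos_add pos_total not_pos_0 in \<open>force simp: algebra_simps\<close>)+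

definition least_key :: "('a \<Rightarrow>\<^sub>0 complex) \<Rightarrow> 'a \<Rightarrow> bool" where
  "least_key F u \<longleftrightarrow> u \<in> Poly_Mapping.keys F \<and> (\<forall>v\<in>Poly_Mapping.keys F. v \<noteq> u \<longrightarrow> P (v - u))"

lemma least_key_exists:
  assumes "F \<noteq> 0"
  obtains u where "least_key F u"
proof -
  have "\<exists>u\<in>A. \<forall>v\<in>A. v \<noteq> u \<longrightarrow> P (v - u)" if "finite A" "A \<noteq> {}" for A :: "'a set"
    using that
  proof (induction A rule: finite_ne_induct)
    case (insert x A)
    then obtain u where u: "u \<in> A" "\<And>v. v \<in> A \<Longrightarrow> v \<noteq> u \<Longrightarrow> P (v - u)" by blast
    have "x \<noteq> u" using u insert by auto
    then consider "P (x - u)" | "P (u - x)" using pos_total[of "x - u"] by auto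
    then show ?case
    proof cases
      case 1 with u show ?thesis by auto
    next
      case 2
      have "P (v - x)" if "v \<in> A" for v
        using pos_add[OF u(2)[OF that] 2] 2 by (cases "v = u") auto
      then show ?thesis by blast
    qed
  qed auto
  moreover have "Poly_Mapping.keys F \<noteq> {}"
    using assms by (metis ex_in_conv in_keys_iff lookup_zero poly_mapping_eqI)
  ultimately show ?thesis using that unfolding least_key_def by (meson finite_keys)
qed

text \<open>The sum of the least keys is attained by no other pair of keys, so nothing cancels there.\<close>

lemma lookup_mult_least_key:
  assumes "least_key F u" "least_key G v"
  shows "Poly_Mapping.lookup (F * G) (u + v) = Poly_Mapping.lookup F u * Poly_Mapping.lookup G v"
proof -
  have unique: "a = u \<and> b = v" if "a \<in> Poly_Mapping.keys F" "b \<in> Poly_Mapping.keys G" "a + b = u + v" for a b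
  proof -
    have eq: "(a - u) + (b - v) = 0" using that(3) by (simp add: algebra_simps)
    have "a = u \<or> P (a - u)" "b = v \<or> P (b - v)"
      using assms that unfolding least_key_def by blast+
    then show ?thesis using pos_add[of "a - u" "b - v"] eq not_pos_0 by auto
  qed
  have "Poly_Mapping.lookup (F * G) (u + v) = (\<Sum>a\<in>Poly_Mapping.keys F. \<Sum>b\<in>Poly_Mapping.keys G.
     if b = v then (if a = u then Poly_Mapping.lookup F a * Poly_Mapping.lookup G b else 0) else 0)"
    unfolding mult_expansion[of F G] lookup_sum
    by (intro sum.cong refl) (auto simp: lookup_single when_def dest: unique)
  also have "\<dots> = Poly_Mapping.lookup F u * Poly_Mapping.lookup G v"
    using assms by (simp add: least_key_def)
  finally show ?thesis .
qed

lemma mult_least_key_in_keys: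
  assumes "least_key F u" "least_key G v"
  shows "u + v \<in> Poly_Mapping.keys (F * G)"
  using lookup_mult_least_key[OF assms] assms by (auto simp: in_keys_iff least_key_def)

lemma least_key_mult:
  assumes "least_key F u" "least_key G v"
  shows "least_key (F * G) (u + v)"
  unfolding least_key_def
proof (intro conjI ballI impI)
  show "u + v \<in> Poly_Mapping.keys (F * G)" by (rule mult_least_key_in_keys) fact+
  fix w assume "w \<in> Poly_Mapping.keys (F * G)" "w \<noteq> u + v"
  then obtain a b where ab: "w = a + b" "a \<in> Poly_Mapping.keys F" "b \<in> Poly_Mapping.keys G"
    using keys_mult by blast
  have "a = u \<or> P (a - u)" "b = v \<or> P (b - v)"
    using assms ab unfolding least_key_def by blast+
  moreover have "\<not> (a = u \<and> b = v)" using ab(1) \<open>w \<noteq> u + v\<close> by blast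
  ultimately have "P ((a - u) + (b - v))" using pos_add[of "a - u" "b - v"] by auto
  also have "(a - u) + (b - v) = w - (u + v)" using ab(1) by simp
  finally show "P (w - (u + v))" .
qed

lemma no_zero_divisors: "F * G = 0 \<Longrightarrow> F = 0 \<or> G = 0" for F G :: "'a \<Rightarrow>\<^sub>0 complex"
  by (metis keys_zero empty_iff least_key_exists mult_least_key_in_keys)

text \<open>If \<open>F\<close> had two different keys, then the products of the least keys and of the greatest keys of \<open>F\<close> and
  \<open>G\<close> would be two different monomials of \<open>F * G\<close>.\<close>

lemma divisor_of_monomial:
  fixes F G :: "'a \<Rightarrow>\<^sub>0 complex"
  assumes "F * G = Poly_Mapping.single t c" "c \<noteq> 0"
  obtains u b where "b \<noteq> 0" "F = Poly_Mapping.single u b"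
proof -
  interpret op: total_group_order "\<lambda>u. P (- u)" by (rule opposite_order)
  have "Poly_Mapping.single t c \<noteq> 0" using assms(2) by (metis lookup_single_eq lookup_zero)
  then have nz: "F \<noteq> 0" "G \<noteq> 0" using assms(1) by auto
  obtain u v u' v' where *: "least_key F u" "least_key G v" "op.least_key F u'" "op.least_key G v'"
    using nz least_key_exists op.least_key_exists by metis
  have "u + v = t" "u' + v' = t"
    using mult_least_key_in_keys[OF *(1,2)] op.mult_least_key_in_keys[OF *(3,4)] assms by auto
  then have eq: "(u' - u) + (v' - v) = 0" by (simp add: algebra_simps)
  have "u' = u \<or> P (u' - u)" "v' = v \<or> P (v' - v)"
    using * unfolding least_key_def op.least_key_def by blast+
  then have "u' = u" using pos_add[of "u' - u" "v' - v"] eq not_pos_0 by auto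
  have "w = u" if "w \<in> Poly_Mapping.keys F" for w
  proof (rule ccontr)
    assume "w \<noteq> u"
    then have "P (w - u)" "P (u - w)"
      using that * \<open>u' = u\<close> unfolding least_key_def op.least_key_def by auto
    then show False using pos_add[of "w - u" "u - w"] not_pos_0 by simp
  qed
  then have "F = Poly_Mapping.single u (Poly_Mapping.lookup F u)"
    by (intro poly_mapping_eqI) (auto simp: lookup_single when_def in_keys_iff)
  moreover have "Poly_Mapping.lookup F u \<noteq> 0" using *(1) by (auto simp: least_key_def in_keys_iff)
  ultimately show ?thesis using that by blast
qed

end

text \<open>The lexicographic order in which a variable with a smaller number \<open>e j\<close> is more significant.  The numbering is
  a parameter because a given variable sometimes has to come first.\<close>

definition lexpos :: "('n \<Rightarrow> nat) \<Rightarrow> ('n \<Rightarrow>\<^sub>0 int) \<Rightarrow> bool" where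
  "lexpos e u \<longleftrightarrow> (\<exists>j. Poly_Mapping.lookup u j > 0 \<and> (\<forall>k. e k < e j \<longrightarrow> Poly_Mapping.lookup u k = 0))"

lemma lexpos_order:
  fixes e :: "'n \<Rightarrow> nat"
  assumes "inj e"
  shows "total_group_order (lexpos e)"
proof
  fix u v :: "'n \<Rightarrow>\<^sub>0 int"
  assume "lexpos e u" "lexpos e v"
  then obtain i j where
    j: "Poly_Mapping.lookup u j > 0" "\<And>k. e k < e j \<Longrightarrow> Poly_Mapping.lookup u k = 0" and
    i: "Poly_Mapping.lookup v i > 0" "\<And>k. e k < e i \<Longrightarrow> Poly_Mapping.lookup v k = 0"
    unfolding lexpos_def by blast
  consider "e i < e j" | "e j < e i" | "i = j" using assms by (metis injD linorder_neqE_nat)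
  then show "lexpos e (u + v)"
    unfolding lexpos_def
    by cases (use i j in \<open>force simp: lookup_add intro: exI[of _ i] exI[of _ j]\<close>)+
next
  fix u :: "'n \<Rightarrow>\<^sub>0 int"
  assume "u \<noteq> 0"
  then obtain i where "Poly_Mapping.lookup u i \<noteq> 0" by (metis lookup_zero poly_mapping_eqI)
  then obtain j where "Poly_Mapping.lookup u j \<noteq> 0" "\<And>k. e k < e j \<Longrightarrow> Poly_Mapping.lookup u k = 0"
    using ex_has_least_nat[of "\<lambda>i. Poly_Mapping.lookup u i \<noteq> 0" i e] by (metis not_le)
  then show "lexpos e u \<or> lexpos e (- u)"
    unfolding lexpos_def by (metis lookup_uminus neg_0_less_iff_less neg_equal_0_iff_equal linorder_neqE_linordered_idom)
qed (auto simp: lexpos_def)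

lemma ex_inj_nat: "\<exists>e :: 'n::finite \<Rightarrow> nat. inj e"
  using finite_imp_inj_to_nat_seg[of "UNIV :: 'n set"] by auto

lemma laurent_mult_eq_0_iff: "F * G = 0 \<longleftrightarrow> F = 0 \<or> G = 0" for F G :: "'n::finite laurent"
proof -
  obtain e :: "'n \<Rightarrow> nat" where "inj e" using ex_inj_nat by blast
  then interpret total_group_order "lexpos e" by (rule lexpos_order)
  show ?thesis using no_zero_divisors[of F G] by auto
qed

lemma laurent_divisor_of_monomial:
  fixes F :: "'n::finite laurent"
  assumes "F dvd X t"
  obtains u b where "b \<noteq> 0" "F = Poly_Mapping.single u b"
proof -
  obtain e :: "'n \<Rightarrow> nat" where "inj e" using ex_inj_nat by blast
  then interpret total_group_order "lexpos e" by (rule lexpos_order)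
  from assms obtain G where "F * G = X t" by (metis dvdE)
  then show ?thesis by (rule divisor_of_monomial) (use that in auto)
qed

lemma laurent_mult_left_cancel:
  fixes F G H :: "'n::finite laurent"
  assumes "F \<noteq> 0"
  shows "F * G = F * H \<longleftrightarrow> G = H"
  using laurent_mult_eq_0_iff[of F "G - H"] assms by (auto simp: right_diff_distrib)

section \<open>The prime binomials\<close>

definition dot :: "('n::finite \<Rightarrow> int) \<Rightarrow> ('n \<Rightarrow>\<^sub>0 int) \<Rightarrow> int" where
  "dot w u = (\<Sum>j\<in>UNIV. w j * Poly_Mapping.lookup u j)"

text \<open>Equivalently, the greatest common divisor of the coordinates of \<open>v\<close> is \<open>1\<close>.  The Bezout form is the
  useful one: it splits off \<open>\<int>v\<close> from the exponent lattice.\<close>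

definition unimodular :: "('n::finite \<Rightarrow>\<^sub>0 int) \<Rightarrow> bool" where
  "unimodular v \<longleftrightarrow> (\<exists>w. dot w v = 1)"

lemma dot_add: "dot w (u + v) = dot w u + dot w v"
  by (simp add: dot_def lookup_add distrib_left sum.distrib)

lemma dot_0 [simp]: "dot w 0 = 0"
  by (simp add: dot_def)

lemma dot_frag_cmul: "dot w (frag_cmul c u) = c * dot w u"
  by (simp add: dot_def sum_distrib_left mult_ac)

lemma bezout_finite:
  fixes u :: "'a \<Rightarrow> int"
  assumes "finite A"
  shows "\<exists>w. (\<Sum>j\<in>A. w j * u j) = Gcd (u ` A)"
  using assms
proof (induction A rule: finite_induct)
  case (insert x A)
  then obtain w where w: "(\<Sum>j\<in>A. w j * u j) = Gcd (u ` A)" by blast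
  obtain a b where ab: "a * u x + b * Gcd (u ` A) = gcd (u x) (Gcd (u ` A))"
    using bezout_int by blast
  have "(\<Sum>j\<in>insert x A. (if j = x then a else b * w j) * u j)
      = a * u x + (\<Sum>j\<in>A. (if j = x then a else b * w j) * u j)"
    using insert by simp
  also have "(\<Sum>j\<in>A. (if j = x then a else b * w j) * u j) = (\<Sum>j\<in>A. b * (w j * u j))"
    by (rule sum.cong) (use insert in auto)
  also have "\<dots> = b * Gcd (u ` A)" unfolding w[symmetric] by (simp add: sum_distrib_left)
  finally show ?case using ab by auto
qed simp

lemma ex_unimodular_divisor:
  fixes u :: "'n::finite \<Rightarrow>\<^sub>0 int"
  assumes "u \<noteq> 0"
  obtains n v where "n > 0" "unimodular v" "u = frag_cmul (int n) v"
proof -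
  define g where "g = Gcd (range (Poly_Mapping.lookup u))"
  obtain w where w: "dot w u = g"
    using bezout_finite[of UNIV "Poly_Mapping.lookup u"] by (auto simp: dot_def g_def)
  have "g \<noteq> 0"
  proof
    assume "g = 0"
    then have "\<forall>j. Poly_Mapping.lookup u j = 0" by (auto simp: g_def Gcd_0_iff)
    with assms show False by (metis lookup_zero poly_mapping_eqI)
  qed
  moreover have "g \<ge> 0" by (simp add: g_def)
  ultimately have "g > 0" by simp
  define v where "v = Poly_Mapping.map (\<lambda>a. a div g) u"
  have "Poly_Mapping.lookup u j = g * Poly_Mapping.lookup v j" for j
  proof -
    have "g dvd Poly_Mapping.lookup u j" by (simp add: g_def Gcd_dvd)
    then show ?thesis by (simp add: v_def map.rep_eq when_def)
  qed
  then have uv: "u = frag_cmul g v" by (intro poly_mapping_eqI) simp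
  have "g * dot w v = g * 1" using w uv by (simp add: dot_frag_cmul)
  then have "dot w v = 1" using \<open>g \<noteq> 0\<close> by simp
  then show ?thesis using that[of "nat g" v] \<open>g > 0\<close> uv by (auto simp: unimodular_def)
qed

lemma unimodular_nonzero: "unimodular v \<Longrightarrow> v \<noteq> 0"
  by (auto simp: unimodular_def)

lemma X_minus_const_nonzero:
  assumes "u \<noteq> 0"
  shows "X u - const z \<noteq> 0"
proof
  assume "X u - const z = 0"
  then have "Poly_Mapping.lookup (X u - const z) u = 0" by simp
  with assms show False by (simp add: lookup_minus lookup_single when_def)
qed

text \<open>With \<open>w \<cdot> v = 1\<close>, an exponent \<open>u\<close> is the sum of \<open>(w \<cdot> u) v\<close> and of an element of the kernel of \<open>w\<close>.
  This map puts \<open>x^v = z\<close> and leaves the kernel part alone; it represents the quotient modulo \<open>x^v - z\<close>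
  by a retract of the ring of Laurent polynomials.\<close>

definition specialize :: "('n::finite \<Rightarrow> int) \<Rightarrow> ('n \<Rightarrow>\<^sub>0 int) \<Rightarrow> complex \<Rightarrow> 'n laurent \<Rightarrow> 'n laurent" where
  "specialize w v z = extend (\<lambda>u. Poly_Mapping.single (u - frag_cmul (dot w u) v) (z powi dot w u))"

lemma monoid_character_specialize:
  assumes "z \<noteq> 0"
  shows "monoid_character (\<lambda>u. Poly_Mapping.single (u - frag_cmul (dot w u) v) (z powi dot w u))"
  by unfold_locales
    (use assms in \<open>simp_all add: dot_add power_int_add mult_single frag_cmul_distrib add_diff_add\<close>)

text \<open>For \<open>k \<ge> 0\<close> this is the divisibility of a difference of powers by the difference; a negative \<open>k\<close> is
  reduced to \<open>-k\<close> by taking out a unit.\<close>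

lemma X_minus_const_dvd_power:
  fixes v :: "'n::finite \<Rightarrow>\<^sub>0 int"
  assumes "z \<noteq> 0"
  shows "X v - const z dvd X (frag_cmul k v) - const (z powi k)"
proof -
  have nat: "X v - const z dvd X (frag_cmul (int n) v) - const (z ^ n)" for n
    unfolding X_power_frag_cmul[symmetric] const_power
    by (cases n) (simp_all add: power_diff_sumr2 del: power_Suc)
  show ?thesis
  proof (cases k)
    case (nonneg n)
    with nat show ?thesis by simp
  next
    case (neg m)
    define n where "n = Suc m"
    have k: "k = - int n" using neg by (simp add: n_def)
    have "X (frag_cmul k v) - const (z powi k)
        = - (X (frag_cmul k v) * const (z powi k)) * (X (frag_cmul (int n) v) - const (z ^ n))"
    proof -
      have "X (frag_cmul k v) * X (frag_cmul (int n) v) = 1"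
        unfolding k by (simp add: mult_single frag_cmul_distrib[symmetric])
      moreover have "const (z powi k) * const (z ^ n) = (1 :: 'n laurent)"
        unfolding k using assms by (simp add: mult_single power_int_minus)
      moreover have "- (a * k) * (b - c) = a * (k * c) - (a * b) * k" for a b c k :: "'n laurent"
        by (simp add: algebra_simps)
      ultimately show ?thesis by simp
    qed
    with nat[of n] show ?thesis by (metis dvd_mult)
  qed
qed

text \<open>Monomial by monomial, \<open>specialize\<close> only replaces a power of \<open>x^v\<close> by the same power of \<open>z\<close>.\<close>

lemma specialize_cong:
  fixes v :: "'n::finite \<Rightarrow>\<^sub>0 int"
  assumes "z \<noteq> 0"
  shows "X v - const z dvd F - specialize w v z F"
proof -
  have "X v - const z dvd Poly_Mapping.single u c - const c * Poly_Mapping.single (u - frag_cmul (dot w u) v) (z powi dot w u)"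
    for u c
  proof -
    let ?k = "dot w u"
    have "Poly_Mapping.single u c - const c * Poly_Mapping.single (u - frag_cmul ?k v) (z powi ?k)
       = Poly_Mapping.single (u - frag_cmul ?k v) c * (X (frag_cmul ?k v) - const (z powi ?k))"
      by (simp add: right_diff_distrib mult_single)
    then show ?thesis by (metis dvd_mult X_minus_const_dvd_power[OF assms])
  qed
  moreover have "F - specialize w v z F = (\<Sum>u\<in>Poly_Mapping.keys F. Poly_Mapping.single u (Poly_Mapping.lookup F u)
      - const (Poly_Mapping.lookup F u) * Poly_Mapping.single (u - frag_cmul (dot w u) v) (z powi dot w u))"
    unfolding specialize_def extend_def by (subst monomial_expansion[of F]) (simp add: sum_subtractf)
  ultimately show ?thesis by (simp add: dvd_sum)
qed

lemma specialize_generator: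
  assumes "z \<noteq> 0" "dot w v = 1"
  shows "specialize w v z (X v - const z) = 0"
  using assms by (simp add: specialize_def extend_diff extend_single mult_single)

lemma dvd_iff_specialize_eq_0:
  assumes "z \<noteq> 0" "dot w v = 1"
  shows "X v - const z dvd F \<longleftrightarrow> specialize w v z F = 0"
proof
  interpret monoid_character "\<lambda>u. Poly_Mapping.single (u - frag_cmul (dot w u) v) (z powi dot w u)"
    by (rule monoid_character_specialize) fact
  assume "X v - const z dvd F"
  then obtain G where "F = (X v - const z) * G" by (rule dvdE)
  with specialize_generator[OF assms] show "specialize w v z F = 0"
    by (simp add: specialize_def extend_mult)
next
  assume "specialize w v z F = 0"
  with specialize_cong[OF assms(1), of v F w] show "X v - const z dvd F" by simp
qed

text \<open>The quotient by \<open>x^v - z\<close> embeds into the ring of Laurent polynomials via \<open>specialize\<close>, and that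
  ring has no zero divisors.\<close>

lemma prime_X_minus_const:
  fixes v :: "'n::finite \<Rightarrow>\<^sub>0 int"
  assumes "z \<noteq> 0" "unimodular v"
  shows "prime_elem (X v - const z)"
proof -
  obtain w where w: "dot w v = 1" using assms by (auto simp: unimodular_def)
  interpret monoid_character "\<lambda>u. Poly_Mapping.single (u - frag_cmul (dot w u) v) (z powi dot w u)"
    by (rule monoid_character_specialize) fact
  show ?thesis
    unfolding prime_elem_def dvd_iff_specialize_eq_0[OF assms(1) w]
    using X_minus_const_nonzero[OF unimodular_nonzero[OF assms(2)]]
    by (simp add: specialize_def extend_mult laurent_mult_eq_0_iff)
qed

text \<open>Specializing \<open>x^v\<close> to \<open>z\<close> turns \<open>g(x^v)\<close> into the constant \<open>g(z)\<close>.\<close>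

lemma dvd_eval_at_same_imp_root:
  fixes v :: "'n::finite \<Rightarrow>\<^sub>0 int"
  assumes "z \<noteq> 0" "unimodular v" "X v - const z dvd eval_at (X v) g"
  shows "poly g z = 0"
proof -
  obtain w where w: "dot w v = 1" using assms by (auto simp: unimodular_def)
  interpret monoid_character "\<lambda>u. Poly_Mapping.single (u - frag_cmul (dot w u) v) (z powi dot w u)"
    by (rule monoid_character_specialize) fact
  have "const (poly g z) = specialize w v z (eval_at (X v) g)"
    by (simp add: specialize_def extend_eval_at extend_single w eval_at_const)
  also have "\<dots> = 0" using assms(3) dvd_iff_specialize_eq_0[OF assms(1) w] by simp
  finally show ?thesis by (metis lookup_single_eq lookup_zero)
qed

lemma prod_mset_laurent_eq_0_iff:
  "(\<Prod>x\<in>#M. h x) = 0 \<longleftrightarrow> (\<exists>x\<in>#M. h x = (0 :: 'n::finite laurent))"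
  by (induction M) (auto simp: laurent_mult_eq_0_iff)

text \<open>Over the complex numbers \<open>g\<close> splits into linear factors, one of which must vanish at \<open>\<xi>\<close>.\<close>

lemma eval_at_eq_0_imp_const:
  fixes \<xi> :: "'n::finite laurent"
  assumes "eval_at \<xi> g = 0" "g \<noteq> 0"
  obtains c where "\<xi> = const c"
proof -
  have "const (lead_coeff g) \<noteq> (0 :: 'n laurent)"
    using assms(2) by (metis lookup_single_eq lookup_zero leading_coeff_0_iff)
  with assms(1) have "\<exists>c\<in>#proots g. \<xi> - const c = 0"
    unfolding eval_at_split[of \<xi> g] laurent_mult_eq_0_iff prod_mset_laurent_eq_0_iff by simp
  with that show ?thesis by auto
qed

text \<open>Specialization turns \<open>x^u\<close> into a scalar times a monomial \<open>x^(u - (w \<cdot> u) v)\<close>.  As a root of \<open>g\<close> this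
  monomial must be constant.\<close>

lemma dvd_eval_at_imp_multiple:
  fixes v :: "'n::finite \<Rightarrow>\<^sub>0 int"
  assumes "z \<noteq> 0" "unimodular v" "g \<noteq> 0" "X v - const z dvd eval_at (X u) g"
  obtains c where "u = frag_cmul c v"
proof -
  obtain w where w: "dot w v = 1" using assms by (auto simp: unimodular_def)
  interpret monoid_character "\<lambda>u. Poly_Mapping.single (u - frag_cmul (dot w u) v) (z powi dot w u)"
    by (rule monoid_character_specialize) fact
  have "eval_at (Poly_Mapping.single (u - frag_cmul (dot w u) v) (z powi dot w u)) g
      = specialize w v z (eval_at (X u) g)"
    by (simp add: specialize_def extend_eval_at extend_single mult_single)
  also have "\<dots> = 0" using assms(4) dvd_iff_specialize_eq_0[OF assms(1) w] by simp
  finally obtain c where "Poly_Mapping.single (u - frag_cmul (dot w u) v) (z powi dot w u) = const c"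
    using assms(3) by (rule eval_at_eq_0_imp_const)
  moreover have "z powi dot w u \<noteq> 0" using assms(1) by simp
  ultimately have "u - frag_cmul (dot w u) v = 0"
    by (metis lookup_single_eq lookup_single_not_eq)
  then show ?thesis using that by auto
qed

lemma unimodular_multiple:
  assumes "unimodular u" "u = frag_cmul c v"
  shows "c = 1 \<or> c = -1"
proof -
  obtain w where "dot w u = 1" using assms by (auto simp: unimodular_def)
  with assms(2) have "c * dot w v = 1" by (simp add: dot_frag_cmul)
  then show ?thesis using zmult_eq_1_iff by blast
qed

text \<open>Among the unimodular \<open>u\<close> only \<open>v\<close> and \<open>-v\<close> are multiples of \<open>v\<close>, and the two are not both positive.
  Thus positivity of the fractions makes different fractions contribute factors without common primes.\<close>

lemma coprime_directions:
  fixes u v :: "'n::finite \<Rightarrow>\<^sub>0 int"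
  assumes e: "inj e" and "z \<noteq> 0" "unimodular u" "unimodular v" "lexpos e u" "lexpos e v"
    and "g \<noteq> 0" "X v - const z dvd eval_at (X u) g"
  shows "u = v"
proof -
  interpret total_group_order "lexpos e" using e by (rule lexpos_order)
  obtain c where c: "u = frag_cmul c v" using assms dvd_eval_at_imp_multiple by metis
  then have "c = 1 \<or> c = -1" using assms unimodular_multiple by blast
  moreover have "c \<noteq> -1"
    using c assms(5,6) pos_add[of u v] not_pos_0 by auto
  ultimately show ?thesis using c by simp
qed

lemma prime_elem_dvd_prodE:
  assumes "prime_elem p" "finite A" "p dvd (\<Prod>i\<in>A. h i)"
  obtains i where "i \<in> A" "p dvd h i"
proof -
  have "\<exists>i\<in>A. p dvd h i"
    using assms(2,3)
  proof (induction A rule: finite_induct)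
    case empty
    then show ?case using assms(1) by (simp add: prime_elem_def)
  next
    case (insert i A)
    then have "p dvd h i * (\<Prod>i\<in>A. h i)" by simp
    then have "p dvd h i \<or> p dvd (\<Prod>i\<in>A. h i)" by (rule prime_elem_dvd_multD[OF assms(1)])
    then show ?case using insert.IH by blast
  qed
  with that show ?thesis by blast
qed

text \<open>Unique factorization for products of these primes: peel off one prime after the other.\<close>

lemma divisor_of_prime_product:
  fixes F :: "'n::finite laurent"
  assumes "F dvd X t * (\<Prod>(v, z)\<in>#M. X v - const z)"
    and "\<And>v z. (v, z) \<in># M \<Longrightarrow> unimodular v \<and> z \<noteq> 0"
  shows "\<exists>u N. u dvd X t \<and> N \<subseteq># M \<and> F = u * (\<Prod>(v, z)\<in>#N. X v - const z)"
  using assms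
proof (induction M arbitrary: F)
  case empty
  then show ?case by (intro exI[of _ F] exI[of _ "{#}"]) simp
next
  case (add a M)
  obtain v z where a: "a = (v, z)" by (cases a)
  let ?\<pi> = "X v - const z"
  have rest: "unimodular v \<and> z \<noteq> 0" if "(v, z) \<in># M" for v z using add.prems(2)[of v z] that by (metis insert_iff set_mset_add_mset_insert)
  have prime: "prime_elem ?\<pi>" using add.prems(2)[of v z] a by (intro prime_X_minus_const) auto
  then have nz: "?\<pi> \<noteq> 0" by auto
  obtain H where H: "X t * (?\<pi> * (\<Prod>(v, z)\<in>#M. X v - const z)) = F * H"
    using add.prems(1) a by (auto elim: dvdE)
  then have "?\<pi> dvd F * H" by (metis dvd_mult dvd_triv_left)
  then consider "?\<pi> dvd F" | "?\<pi> dvd H" using prime_elem_dvd_multD[OF prime] by blast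
  then show ?case
  proof cases
    case 1
    then obtain F' where F': "F = ?\<pi> * F'" by (rule dvdE)
    have "?\<pi> * (X t * (\<Prod>(v, z)\<in>#M. X v - const z)) = ?\<pi> * (F' * H)"
      using H F' by (simp only: mult_ac)
    then have "F' dvd X t * (\<Prod>(v, z)\<in>#M. X v - const z)"
      using nz by (metis laurent_mult_left_cancel dvd_triv_left)
    then obtain u N where "u dvd X t" "N \<subseteq># M" "F' = u * (\<Prod>(v, z)\<in>#N. X v - const z)"
      using add.IH[OF _ rest] by blast
    then show ?thesis using F' a
      by (intro exI[of _ u] exI[of _ "add_mset a N"]) (simp add: mult_ac)
  next
    case 2
    then obtain H' where H': "H = ?\<pi> * H'" by (rule dvdE)
    have "?\<pi> * (X t * (\<Prod>(v, z)\<in>#M. X v - const z)) = ?\<pi> * (F * H')"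
      using H H' by (simp only: mult_ac)
    then have "F dvd X t * (\<Prod>(v, z)\<in>#M. X v - const z)"
      using nz by (metis laurent_mult_left_cancel dvd_triv_left)
    then obtain u N where "u dvd X t" "N \<subseteq># M" "F = u * (\<Prod>(v, z)\<in>#N. X v - const z)"
      using add.IH[OF _ rest] by blast
    moreover have "N \<subseteq># add_mset a M" using \<open>N \<subseteq># M\<close>
      by (metis add_mset_add_single mset_subset_eq_add_left subset_mset.order_trans)
    ultimately show ?thesis by blast
  qed
qed

text \<open>A factor \<open>C\<close> prime to all \<open>x^v - z\<close> can be discarded, after which divisibility between polynomials
  in \<open>x^v\<close> comes down to divisibility in one variable.\<close>

lemma linear_factors_dvd_eval_at_mult:
  fixes v :: "'n::finite \<Rightarrow>\<^sub>0 int" and C :: "'n laurent"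
  assumes v: "unimodular v"
    and "\<And>z. z \<in># M \<Longrightarrow> z \<noteq> 0 \<and> \<not> X v - const z dvd C"
    and "(\<Prod>z\<in>#M. X v - const z) dvd eval_at (X v) g * C"
  shows "(\<Prod>z\<in>#M. [:- z, 1:]) dvd g"
  using assms(2,3)
proof (induction M arbitrary: g)
  case (add z M)
  let ?\<pi> = "X v - const z"
  have z: "z \<noteq> 0" "\<not> ?\<pi> dvd C" using add.prems(1)[of z] by auto
  have prime: "prime_elem ?\<pi>" using z v by (intro prime_X_minus_const)
  have "?\<pi> dvd eval_at (X v) g * C" using add.prems(2) by (auto intro: dvd_trans[OF dvd_triv_left])
  then have "?\<pi> dvd eval_at (X v) g" using prime z by (metis prime_elem_dvd_multD)
  then have "poly g z = 0" using v z by (intro dvd_eval_at_same_imp_root)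
  then obtain h where h: "g = [:- z, 1:] * h" by (auto simp: poly_eq_0_iff_dvd elim: dvdE)
  obtain H where "eval_at (X v) g * C = ?\<pi> * (\<Prod>z\<in>#M. X v - const z) * H"
    using add.prems(2) by (auto elim: dvdE)
  then have "?\<pi> * (eval_at (X v) h * C) = ?\<pi> * ((\<Prod>z\<in>#M. X v - const z) * H)"
    unfolding h eval_at_mult eval_at_linear by (simp only: mult_ac)
  then have "(\<Prod>z\<in>#M. X v - const z) dvd eval_at (X v) h * C"
    using prime by (subst (asm) laurent_mult_left_cancel) auto
  then have "(\<Prod>z\<in>#M. [:- z, 1:]) dvd h" using add.prems(1) by (intro add.IH) auto
  then show ?case unfolding h by (simp add: mult_dvd_mono del: mult_pCons_left)
qed simp

section \<open>Polynomials as Laurent polynomials\<close>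

lemma X_power: "X u ^ n = (X (\<Sum>k<n. u) :: 'k::comm_monoid_add \<Rightarrow>\<^sub>0 complex)"
  by (simp add: X_sum)

lemma subst_eq_extend: "subst v f = extend (\<lambda>p. \<Prod>j\<in>UNIV. v j ^ Poly_Mapping.lookup p j) f"
  by (simp add: subst_def extend_def)

lemma lookup_map_int [simp]: "Poly_Mapping.lookup (Poly_Mapping.map int p) j = int (Poly_Mapping.lookup p j)"
  by (simp add: map.rep_eq when_def)

lemma map_int_0 [simp]: "Poly_Mapping.map int 0 = 0"
  by (rule poly_mapping_eqI) simp

lemma map_int_add: "Poly_Mapping.map int (p + q) = Poly_Mapping.map int p + Poly_Mapping.map int q"
  by (rule poly_mapping_eqI) (simp add: lookup_add)

lemma inj_map_int: "inj (Poly_Mapping.map int)"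
proof
  fix p q :: "'a \<Rightarrow>\<^sub>0 nat"
  assume "Poly_Mapping.map int p = Poly_Mapping.map int q"
  then have "int (Poly_Mapping.lookup p j) = int (Poly_Mapping.lookup q j)" for j by (metis lookup_map_int)
  then show "p = q" by (intro poly_mapping_eqI) simp
qed

lemma to_laurent_eq_extend:
  fixes f :: "'n::finite mpoly"
  shows "to_laurent f = extend (\<lambda>p. X (Poly_Mapping.map int p)) f"
proof -
  have "(\<Prod>j\<in>UNIV. lvar j ^ Poly_Mapping.lookup p j) = X (Poly_Mapping.map int p)" for p :: "'n exponent"
    unfolding lvar_def X_power X_sum[symmetric]
    by (rule arg_cong[of _ _ X], rule poly_mapping_eqI)
       (simp add: lookup_sum lookup_single when_def if_distrib[of "\<lambda>x. _ * x"] cong: if_cong)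
  then show ?thesis by (simp add: to_laurent_def subst_eq_extend)
qed

lemma power_subst_eq_extend:
  fixes f :: "'n::finite mpoly"
  shows "power_subst m f = extend (\<lambda>p. X (Poly_Mapping.map ((*) m) p)) f"
proof -
  have "(\<Prod>j\<in>UNIV. (mvar j ^ m) ^ Poly_Mapping.lookup p j) = X (Poly_Mapping.map ((*) m) p)" for p :: "'n exponent"
    unfolding mvar_def X_power X_sum[symmetric]
    by (rule arg_cong[of _ _ X], rule poly_mapping_eqI)
       (simp add: lookup_sum lookup_single when_def map.rep_eq if_distrib[of "\<lambda>x. _ * x"] cong: if_cong)
  then show ?thesis by (simp add: power_subst_def subst_eq_extend)
qed

interpretation to_laurent: monoid_character "\<lambda>p::'n exponent. X (Poly_Mapping.map int p)"
  by (rule monoid_character_X) (simp_all add: map_int_add)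

lemma to_laurent_mult: "to_laurent (f * g) = to_laurent f * to_laurent g"
  by (simp add: to_laurent_eq_extend to_laurent.extend_mult)

lemma to_laurent_monomial: "to_laurent (X p) = X (Poly_Mapping.map int p)"
  by (simp add: to_laurent_eq_extend extend_single)

lemma lookup_to_laurent: "Poly_Mapping.lookup (to_laurent f) (Poly_Mapping.map int p) = Poly_Mapping.lookup f p"
  unfolding to_laurent_eq_extend by (rule lookup_extend_X[OF inj_map_int])

lemma inj_to_laurent: "inj to_laurent"
  by (intro injI poly_mapping_eqI) (metis lookup_to_laurent)

lemma to_laurent_eq_0_iff: "to_laurent f = 0 \<longleftrightarrow> f = 0"
  using inj_to_laurent by (metis extend_0 injD to_laurent_eq_extend)

lemma keys_to_laurent: "Poly_Mapping.keys (to_laurent f) \<subseteq> Poly_Mapping.map int ` Poly_Mapping.keys f"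
  unfolding to_laurent_eq_extend by (rule keys_extend_X)

lemma range_to_laurent:
  assumes "\<And>u j. u \<in> Poly_Mapping.keys h \<Longrightarrow> Poly_Mapping.lookup u j \<ge> 0"
  obtains r where "h = to_laurent r"
proof -
  have "to_laurent (extend (\<lambda>u. X (Poly_Mapping.map nat u)) h)
      = (\<Sum>u\<in>Poly_Mapping.keys h. Poly_Mapping.single (Poly_Mapping.map int (Poly_Mapping.map nat u)) (Poly_Mapping.lookup h u))"
    by (simp add: to_laurent_eq_extend extend_def[of _ h] extend_sum extend_single mult_single)
  also have "\<dots> = (\<Sum>u\<in>Poly_Mapping.keys h. Poly_Mapping.single u (Poly_Mapping.lookup h u))"
  proof (rule sum.cong)
    fix u assume "u \<in> Poly_Mapping.keys h"
    then have "Poly_Mapping.map int (Poly_Mapping.map nat u) = u"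
      by (intro poly_mapping_eqI) (use assms[of u] in \<open>simp add: map.rep_eq[of nat] when_def\<close>)
    then show "Poly_Mapping.single (Poly_Mapping.map int (Poly_Mapping.map nat u)) (Poly_Mapping.lookup h u)
      = Poly_Mapping.single u (Poly_Mapping.lookup h u)" by simp
  qed simp
  also have "\<dots> = h" by (rule monomial_expansion[symmetric])
  finally show ?thesis using that by metis
qed

text \<open>The extension of \<open>power_subst m\<close> to Laurent polynomials.\<close>

definition dilation :: "nat \<Rightarrow> 'n laurent \<Rightarrow> 'n laurent" where
  "dilation m = extend (\<lambda>u. X (frag_cmul (int m) u))"

interpretation dilation: monoid_character "\<lambda>u::'n \<Rightarrow>\<^sub>0 int. X (frag_cmul (int m) u)" for m
  by (rule monoid_character_X) (simp_all add: frag_cmul_distrib2)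

lemma to_laurent_power_subst:
  fixes f :: "'n::finite mpoly"
  shows "to_laurent (power_subst m f) = dilation m (to_laurent f)"
proof -
  have "Poly_Mapping.map int (Poly_Mapping.map ((*) m) p) = frag_cmul (int m) (Poly_Mapping.map int p)" for p :: "'n exponent"
    by (rule poly_mapping_eqI) (simp add: map.rep_eq[of "(*) m"] when_def)
  then show ?thesis
    unfolding to_laurent_eq_extend power_subst_eq_extend dilation_def
    by (simp add: extend_def[of _ f] extend_sum extend_single mult_single)
qed

lemma power_subst_mult: "power_subst m (f * g) = power_subst m f * power_subst m g"
proof (rule injD[OF inj_to_laurent])
  show "to_laurent (power_subst m (f * g)) = to_laurent (power_subst m f * power_subst m g)"
    unfolding to_laurent_power_subst to_laurent_mult
    by (simp add: dilation_def dilation.extend_mult)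
qed

lemma dilation_eval_at: "dilation m (eval_at (X u) g) = eval_at (X u) (pcompose g (monom 1 m))"
  by (simp add: dilation_def dilation.extend_eval_at extend_single eval_at_substitute_power X_power_frag_cmul)

text \<open>Fix a variable \<open>x_j\<close> and order monomials lexicographically with \<open>x_j\<close> first, so that the least monomial
  of a Laurent polynomial has the smallest exponent of \<open>x_j\<close>.  If \<open>a \<ge> 0\<close> is that exponent for \<open>f\<close>, then
  in \<open>f^(m)\<close> no exponent is below \<open>m a \<ge> a\<close>, hence the smallest exponent for the quotient \<open>h\<close> is not negative.\<close>

lemma laurent_quotient_is_polynomial:
  fixes f :: "'n::finite mpoly"
  assumes "f \<noteq> 0" "m \<ge> 1" "to_laurent f * h = to_laurent (power_subst m f)"
  obtains r where "h = to_laurent r"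
proof (rule range_to_laurent[of h])
  fix u0 :: "'n \<Rightarrow>\<^sub>0 int" and j
  assume u0: "u0 \<in> Poly_Mapping.keys h"
  obtain e0 :: "'n \<Rightarrow> nat" where "inj e0" using ex_inj_nat by blast
  (* a numbering that makes the variable j the most significant one *)
  define e where "e k = (if k = j then 0 else Suc (e0 k))" for k
  have "inj e" using \<open>inj e0\<close> by (auto simp: inj_def e_def)
  then interpret total_group_order "lexpos e" by (rule lexpos_order)
  have coord: "Poly_Mapping.lookup u j \<ge> Poly_Mapping.lookup v j"
    if "least_key G v" "u \<in> Poly_Mapping.keys G" for G u v
  proof (cases "u = v")
    case False
    with that have "lexpos e (u - v)" by (auto simp: least_key_def)
    then obtain i where "Poly_Mapping.lookup (u - v) i > 0" "e j < e i \<longrightarrow> Poly_Mapping.lookup (u - v) j = 0"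
      unfolding lexpos_def by blast
    then show ?thesis by (cases "i = j") (auto simp: e_def lookup_minus)
  qed simp
  let ?F = "to_laurent f"
  have "?F \<noteq> 0" using assms(1) by (simp add: to_laurent_eq_0_iff)
  then obtain a where a: "least_key ?F a" by (rule least_key_exists)
  have "h \<noteq> 0" using u0 by auto
  then obtain b where b: "least_key h b" by (rule least_key_exists)
  have "a + b \<in> Poly_Mapping.keys (dilation m ?F)"
    using mult_least_key_in_keys[OF a b] assms(3) by (simp add: to_laurent_power_subst)
  then obtain a' where a': "a + b = frag_cmul (int m) a'" "a' \<in> Poly_Mapping.keys ?F"
    using keys_extend_X[of _ ?F] unfolding dilation_def by blast
  have "a \<in> Poly_Mapping.keys ?F" using a by (simp add: least_key_def)
  then have "Poly_Mapping.lookup a j \<ge> 0" using keys_to_laurent[of f] by auto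
  moreover have "Poly_Mapping.lookup a j \<le> Poly_Mapping.lookup a' j" using coord[OF a a'(2)] .
  moreover have "Poly_Mapping.lookup a' j \<le> int m * Poly_Mapping.lookup a' j"
    using assms(2) calculation mult_right_mono[of 1 "int m" "Poly_Mapping.lookup a' j"] by simp
  moreover have "Poly_Mapping.lookup a j + Poly_Mapping.lookup b j = int m * Poly_Mapping.lookup a' j"
    using a'(1) by (metis lookup_add lookup_frag_cmul)
  ultimately have "Poly_Mapping.lookup b j \<ge> 0" by linarith
  with coord[OF b u0] show "Poly_Mapping.lookup u0 j \<ge> 0" by linarith
qed (use that in auto)

lemma dvd_power_subst_iff:
  assumes "f \<noteq> 0" "m \<ge> 1"
  shows "f dvd power_subst m f \<longleftrightarrow> to_laurent f dvd dilation m (to_laurent f)"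
proof
  assume "f dvd power_subst m f"
  then show "to_laurent f dvd dilation m (to_laurent f)"
    by (metis dvd_def to_laurent_mult to_laurent_power_subst)
next
  assume "to_laurent f dvd dilation m (to_laurent f)"
  then obtain h where h: "to_laurent f * h = to_laurent (power_subst m f)"
    by (metis dvdE to_laurent_power_subst)
  with assms obtain r where "h = to_laurent r" by (rule laurent_quotient_is_polynomial)
  with h have "power_subst m f = f * r" using injD[OF inj_to_laurent] to_laurent_mult by metis
  then show "f dvd power_subst m f" by simp
qed

lemma power_closed_principal_ideal_iff:
  "power_closed_ideal (principal_ideal f) \<longleftrightarrow> (\<forall>m\<ge>1. f dvd power_subst m f)"
proof -
  have mem: "a \<in> principal_ideal f \<longleftrightarrow> f dvd a" for a
    by (auto simp: principal_ideal_def dvd_def mult.commute)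
  have "is_ideal (principal_ideal f)"
    by (auto simp: is_ideal_def mem)
  moreover have "f dvd power_subst m a" if "f dvd a" "f dvd power_subst m f" for m a
  proof -
    from \<open>f dvd a\<close> obtain r where "a = f * r" by (rule dvdE)
    with that(2) show ?thesis by (simp add: power_subst_mult)
  qed
  ultimately show ?thesis
    unfolding power_closed_ideal_def by (metis mem dvd_refl)
qed

text \<open>The map \<open>F \<mapsto> F^(m)\<close> acts on each factor separately, and \<open>g(x^u)\<close> divides \<open>g(x^(m u))\<close> because \<open>g(x)\<close> divides \<open>g(x^m)\<close>.\<close>

lemma product_dvd_dilation:
  assumes "m \<ge> 1" "\<And>i. i \<in> I \<Longrightarrow> power_polynomial (g i)"
  shows "X t * (\<Prod>i\<in>I. eval_at (X (u i)) (g i)) dvd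
    dilation m (X t * (\<Prod>i\<in>I. eval_at (X (u i)) (g i)))"
proof -
  have eq: "dilation m (X t * (\<Prod>i\<in>I. eval_at (X (u i)) (g i)))
     = X t ^ m * (\<Prod>i\<in>I. eval_at (X (u i)) (pcompose (g i) (monom 1 m)))"
    by (simp add: dilation_def dilation.extend_mult dilation.extend_prod extend_single X_power_frag_cmul
        dilation_eval_at[unfolded dilation_def])
  have "X t dvd X t ^ m" using assms(1) by (intro dvd_power) auto
  moreover have "(\<Prod>i\<in>I. eval_at (X (u i)) (g i)) dvd (\<Prod>i\<in>I. eval_at (X (u i)) (pcompose (g i) (monom 1 m)))"
    by (intro prod_dvd_prod eval_at_dvd) (use assms in \<open>auto simp: power_polynomial_def\<close>)
  ultimately show ?thesis unfolding eq by (rule mult_dvd_mono)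
qed

section \<open>Factoring polynomials that divide all their dilations\<close>

definition binomials :: "(('n \<Rightarrow>\<^sub>0 int) \<times> complex) multiset \<Rightarrow> 'n::finite laurent" where
  "binomials M = (\<Prod>(v, z)\<in>#M. X v - const z)"

definition admissible :: "('n \<Rightarrow> nat) \<Rightarrow> (('n::finite \<Rightarrow>\<^sub>0 int) \<times> complex) multiset \<Rightarrow> bool" where
  "admissible e M \<longleftrightarrow> (\<forall>(v, z)\<in>#M. unimodular v \<and> lexpos e v \<and> z \<noteq> 0)"

lemma dilation_eq_sum:
  "dilation m F = (\<Sum>u\<in>Poly_Mapping.keys F. const (Poly_Mapping.lookup F u) * X u ^ m)"
  by (simp add: dilation_def extend_def X_power_frag_cmul)

text \<open>The sum is an \<open>L\<close>-linear combination of the dilations \<open>F^(i+1)\<close>, with the coefficients of \<open>H\<close>; the extra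
  factor \<open>x^u\<close> avoids the dilation with exponent \<open>0\<close>.\<close>

lemma dvd_interpolation:
  fixes F :: "'n::finite laurent" and H :: "'n laurent poly"
  assumes "\<And>m. m \<ge> 1 \<Longrightarrow> F dvd dilation m F"
  shows "F dvd (\<Sum>u\<in>Poly_Mapping.keys F. const (Poly_Mapping.lookup F u) * (X u * poly H (X u)))"
proof -
  have "(\<Sum>u\<in>Poly_Mapping.keys F. const (Poly_Mapping.lookup F u) * (X u * poly H (X u)))
     = (\<Sum>u\<in>Poly_Mapping.keys F. \<Sum>i\<le>degree H. coeff H i * (const (Poly_Mapping.lookup F u) * X u ^ Suc i))"
    by (simp only: poly_altdef sum_distrib_left power_Suc mult_ac)
  also have "\<dots> = (\<Sum>i\<le>degree H. coeff H i * dilation (Suc i) F)"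
    unfolding dilation_eq_sum sum_distrib_left by (rule sum.swap)
  finally show ?thesis using assms by (simp add: dvd_sum)
qed

text \<open>An elimination argument in the style of Vandermonde: a polynomial in an auxiliary variable that vanishes at
  all monomials of \<open>F\<close> but one isolates a single term.\<close>

lemma dvd_prod_support_differences:
  fixes F :: "'n::finite laurent"
  assumes "\<And>m. m \<ge> 1 \<Longrightarrow> F dvd dilation m F" and u0: "u0 \<in> Poly_Mapping.keys F"
  shows "F dvd (\<Prod>u\<in>Poly_Mapping.keys F - {u0}. X u0 - X u)"
proof -
  let ?S = "Poly_Mapping.keys F" and ?c = "Poly_Mapping.lookup F u0"
  define H :: "'n laurent poly" where "H = (\<Prod>u\<in>?S - {u0}. [:- X u, 1:])"
  have H: "poly H (X w) = (\<Prod>u\<in>?S - {u0}. X w - X u)" for w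
    by (simp add: H_def poly_prod)
  have "poly H (X w) = 0" if "w \<in> ?S - {u0}" for w
    unfolding H using that by (intro prod_zero) auto
  then have "(\<Sum>u\<in>?S. const (Poly_Mapping.lookup F u) * (X u * poly H (X u)))
      = const ?c * (X u0 * poly H (X u0))"
    using u0 by (subst sum.remove[of _ u0]) auto
  also have "\<dots> = Poly_Mapping.single u0 ?c * poly H (X u0)"
    by (simp add: mult_single mult.assoc[symmetric])
  finally have "F dvd Poly_Mapping.single u0 ?c * poly H (X u0)"
    using dvd_interpolation[OF assms(1), of H] by simp
  then show ?thesis using u0 by (simp add: monomial_mult_dvd_iff in_keys_iff H)
qed

text \<open>Up to a unit the difference is \<open>x^d - 1\<close> with \<open>d\<close> positive.  For \<open>d = n v\<close> with \<open>v\<close> unimodular it is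
  \<open>g(x^v)\<close> for \<open>g(x) = x^n - 1\<close>, which splits into linear factors with nonzero roots.\<close>

lemma difference_dvd_binomials:
  fixes u v :: "'n::finite \<Rightarrow>\<^sub>0 int"
  assumes e: "inj e" and "u \<noteq> v"
  obtains M where "admissible e M" "X u - X v dvd binomials M"
proof -
  interpret total_group_order "lexpos e" using e by (rule lexpos_order)
  have *: "\<exists>M. admissible e M \<and> X d - 1 dvd binomials M" if "lexpos e d" for d :: "'n \<Rightarrow>\<^sub>0 int"
  proof -
    have "d \<noteq> 0" using that not_pos_0 by auto
    then obtain n v where v: "n > 0" "unimodular v" "d = frag_cmul (int n) v"
      by (rule ex_unimodular_divisor)
    have "lexpos e v"
      using that v(1,3) unfolding lexpos_def by (auto simp: zero_less_mult_iff)
    define g :: "complex poly" where "g = monom 1 n - 1"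
    have "poly g 0 \<noteq> 0" using v(1) by (simp add: g_def poly_monom zero_power)
    then have "g \<noteq> 0" by auto
    define M where "M = image_mset (Pair v) (proots g)"
    have "admissible e M"
      using v \<open>lexpos e v\<close> \<open>g \<noteq> 0\<close> \<open>poly g 0 \<noteq> 0\<close> by (auto simp: M_def admissible_def)
    moreover have "X d - 1 = eval_at (X v) g"
    proof -
      have "eval_at (X v) g + eval_at (X v) 1 = eval_at (X v) (monom 1 n)"
        by (simp only: eval_at_add[symmetric]) (simp add: g_def)
      also have "\<dots> = X d" by (simp add: eval_at_monom X_power_frag_cmul v)
      finally show ?thesis by (metis add_diff_cancel_right' eval_at_1)
    qed
    then have "X d - 1 = const (lead_coeff g) * binomials M"
      by (simp add: eval_at_split[of _ g] binomials_def M_def image_mset.compositionality o_def)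
    then have "X d - 1 dvd binomials M"
      using \<open>g \<noteq> 0\<close> by (metis dvd_refl leading_coeff_0_iff monomial_mult_dvd_iff)
    ultimately show ?thesis by blast
  qed
  consider "lexpos e (u - v)" | "lexpos e (v - u)" using assms(2) pos_total[of "u - v"] by auto
  then show ?thesis
  proof cases
    case 1
    have "X u - X v = X v * (X (u - v) - 1)" by (simp add: right_diff_distrib mult_single)
    with *[OF 1] that show ?thesis by (metis monomial_dvd_1 mult_1 mult_dvd_mono one_neq_zero)
  next
    case 2
    have "X u - X v = - X u * (X (v - u) - 1)" by (simp add: right_diff_distrib mult_single)
    with *[OF 2] that show ?thesis
      by (metis monomial_dvd_1 mult_1 mult_dvd_mono one_neq_zero minus_dvd_iff)
  qed
qed

lemma binomials_union: "binomials (M + N) = binomials M * binomials N"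
  by (simp add: binomials_def)

text \<open>A product of differences of monomials is a unit times a product of positive prime binomials.  A divisor of it
  is a subproduct up to a unit, and the units are the monomials.\<close>

lemma power_divisor_factorization:
  fixes F :: "'n::finite laurent"
  assumes e: "inj e" and F: "\<And>m. m \<ge> 1 \<Longrightarrow> F dvd dilation m F" "F \<noteq> 0"
  obtains t c N where "c \<noteq> 0" "admissible e N" "F = Poly_Mapping.single t c * binomials N"
proof -
  obtain u0 where u0: "u0 \<in> Poly_Mapping.keys F"
    using F(2) by (metis ex_in_conv in_keys_iff lookup_zero poly_mapping_eqI)
  have "\<exists>M. admissible e M \<and> (\<Prod>u\<in>A. X u0 - X u) dvd binomials M" if "finite A" "u0 \<notin> A" for A
    using that
  proof (induction A rule: finite_induct)
    case empty
    show ?case by (intro exI[of _ "{#}"]) (simp add: admissible_def)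
  next
    case (insert u A)
    then obtain M where "admissible e M" "(\<Prod>u\<in>A. X u0 - X u) dvd binomials M" by blast
    moreover obtain M' where "admissible e M'" "X u0 - X u dvd binomials M'"
      using difference_dvd_binomials[OF e, of u0 u] insert by blast
    ultimately have "admissible e (M' + M)"
      "(X u0 - X u) * (\<Prod>u\<in>A. X u0 - X u) dvd binomials M' * binomials M"
      by (auto simp: admissible_def) (rule mult_dvd_mono)
    then have "admissible e (M' + M)" "(\<Prod>u\<in>insert u A. X u0 - X u) dvd binomials (M' + M)"
      using insert.hyps by (simp_all add: binomials_union)
    then show ?case by blast
  qed
  from this[of "Poly_Mapping.keys F - {u0}"]
  obtain M where M: "admissible e M" "(\<Prod>u\<in>Poly_Mapping.keys F - {u0}. X u0 - X u) dvd binomials M"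
    by auto
  have "F dvd X 0 * binomials M"
    using dvd_trans[OF dvd_prod_support_differences[OF F(1) u0] M(2)] by simp
  moreover have "unimodular v \<and> z \<noteq> 0" if "(v, z) \<in># M" for v z
    using M(1) that by (auto simp: admissible_def)
  ultimately obtain u N where N: "u dvd X 0" "N \<subseteq># M" "F = u * binomials N"
    using divisor_of_prime_product[of F 0 M] unfolding binomials_def by blast
  from N(1) obtain t c where "c \<noteq> 0" "u = Poly_Mapping.single t c"
    by (rule laurent_divisor_of_monomial)
  moreover have "admissible e N" using M(1) mset_subset_eqD[OF N(2)] unfolding admissible_def by blast
  ultimately show ?thesis using N(3) that by blast
qed

text \<open>Since \<open>v\<close> is positive, the least monomial of \<open>x^v - z\<close> is the constant \<open>-z\<close>, so the product of binomials has a
  nonzero constant term.\<close>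

lemma monomial_in_keys_monomial_mult_binomials:
  assumes e: "inj e" and "admissible e N"  "c \<noteq> 0"
  shows "t \<in> Poly_Mapping.keys (Poly_Mapping.single t c * binomials N)"
proof -
  interpret total_group_order "lexpos e" using e by (rule lexpos_order)
  have lin: "least_key (X v - const z) 0" if "lexpos e v" "z \<noteq> 0" for v z
  proof -
    have "v \<noteq> 0" using that not_pos_0 by auto
    then show ?thesis using that
      by (auto simp: least_key_def in_keys_iff lookup_minus lookup_single when_def split: if_splits)
  qed
  have one: "least_key 1 0" by (simp add: least_key_def)
  have "least_key (binomials N) 0"
    using assms(2)
  proof (induction N)
    case (add a N)
    obtain v z where a: "a = (v, z)" by (cases a)
    have "least_key (X v - const z) 0" using add.prems a by (intro lin) (auto simp: admissible_def)
    moreover have "least_key (binomials N) 0" using add by (auto simp: admissible_def)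
    ultimately have "least_key ((X v - const z) * binomials N) (0 + 0)" by (rule least_key_mult)
    then show ?case by (simp add: binomials_def a)
  qed (simp add: binomials_def one)
  moreover have "least_key (Poly_Mapping.single t c) t" using assms by (simp add: least_key_def)
  ultimately have "t + 0 \<in> Poly_Mapping.keys (Poly_Mapping.single t c * binomials N)"
    by (intro mult_least_key_in_keys)
  then show ?thesis by simp
qed

definition factor_at :: "(('n::finite \<Rightarrow>\<^sub>0 int) \<times> complex) multiset \<Rightarrow> ('n \<Rightarrow>\<^sub>0 int) \<Rightarrow> complex poly" where
  "factor_at N v = (\<Prod>z\<in>#image_mset snd (filter_mset (\<lambda>a. fst a = v) N). [:- z, 1:])"

lemma factor_at_nonzero: "factor_at N v \<noteq> 0"
  by (auto simp: factor_at_def)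

lemma eval_at_factor_at:
  "eval_at (X v) (factor_at N v) = (\<Prod>z\<in>#image_mset snd (filter_mset (\<lambda>a. fst a = v) N). X v - const z)"
  by (simp only: factor_at_def eval_at_prod_mset eval_at_linear)

lemma binomials_group:
  assumes "finite V" "fst ` set_mset N \<subseteq> V"
  shows "binomials N = (\<Prod>v\<in>V. eval_at (X v) (factor_at N v))"
  using assms(2)
proof (induction N)
  case (add a N)
  obtain w z where a: "a = (w, z)" by (cases a)
  have "eval_at (X v) (factor_at (add_mset a N) v)
      = (if v = w then X v - const z else 1) * eval_at (X v) (factor_at N v)" for v
    by (simp add: eval_at_factor_at a)
  then have "(\<Prod>v\<in>V. eval_at (X v) (factor_at (add_mset a N) v))
      = (\<Prod>v\<in>V. if v = w then X v - const z else 1) * binomials N"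
    using add by (simp add: prod.distrib)
  also have "(\<Prod>v\<in>V. if v = w then X v - const z else 1) = X w - const z"
    using assms(1) add.prems a by (simp add: prod.delta)
  finally show ?case by (simp add: binomials_def a)
qed (simp add: binomials_def factor_at_def)

text \<open>\<open>g_v(x^v)\<close> divides \<open>F\<close>, hence \<open>F^(m)\<close>, which is a unit times the product of all \<open>g_w((x^w)^m)\<close>.  The factors with
  \<open>w \<noteq> v\<close> are prime to \<open>g_v(x^v)\<close> and can be discarded.\<close>

lemma factor_at_dvd_substitute_power:
  fixes N :: "(('n::finite \<Rightarrow>\<^sub>0 int) \<times> complex) multiset"
  assumes e: "inj e" and N: "admissible e N" and c: "c \<noteq> 0"
    and F: "F = Poly_Mapping.single t c * binomials N" "\<And>m. m \<ge> 1 \<Longrightarrow> F dvd dilation m F"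
    and m: "m \<ge> 1"
  shows "factor_at N v dvd pcompose (factor_at N v) (monom 1 m)"
proof -
  let ?g = "factor_at N" and ?h = "\<lambda>v. pcompose (factor_at N v) (monom 1 m)"
  define V where "V = fst ` set_mset N"
  have [simp, intro]: "finite V" "finite (V - {v})" by (simp_all add: V_def)
  show ?thesis
  proof (cases "v \<in> V")
    case False
    then have "filter_mset (\<lambda>a. fst a = v) N = {#}" by (force simp: V_def)
    then have "?g v = 1" unfolding factor_at_def by (simp only: image_mset_empty prod_mset_empty)
    then show ?thesis by simp
  next
    case True
    then have v: "unimodular v" "lexpos e v" using N by (auto simp: V_def admissible_def)
    define M where "M = image_mset snd (filter_mset (\<lambda>a. fst a = v) N)"
    define C where "C = (\<Prod>w\<in>V - {v}. eval_at (X w) (?h w))"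
    have "dilation m F = Poly_Mapping.single (frag_cmul (int m) t) c * (\<Prod>w\<in>V. eval_at (X w) (?h w))"
    proof -
      have "F = Poly_Mapping.single t c * (\<Prod>w\<in>V. eval_at (X w) (?g w))"
        unfolding F(1) by (subst binomials_group[of V]) (simp_all add: V_def)
      then show ?thesis
        by (simp add: dilation_def dilation.extend_mult dilation.extend_prod extend_single mult_single
            dilation_eval_at[unfolded dilation_def])
    qed
    also have "(\<Prod>w\<in>V. eval_at (X w) (?h w)) = eval_at (X v) (?h v) * C"
      unfolding C_def using True by (simp add: prod.remove)
    finally have "F dvd eval_at (X v) (?h v) * C"
      using F(2)[OF m] monomial_mult_dvd_iff[OF c] by metis
    moreover have "eval_at (X v) (?g v) dvd F"
    proof -
      have "eval_at (X v) (?g v) dvd (\<Prod>w\<in>V. eval_at (X w) (?g w))"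
        using True by (intro dvd_prodI) auto
      also have "\<dots> = binomials N" by (rule binomials_group[symmetric]) (simp_all add: V_def)
      finally show ?thesis unfolding F(1) by (rule dvd_mult)
    qed
    ultimately have dvd: "eval_at (X v) (?g v) dvd eval_at (X v) (?h v) * C" by (rule dvd_trans[rotated])
    have coprime: "z \<noteq> 0 \<and> \<not> X v - const z dvd C"
      if "z \<in># M" for z
    proof
      show z: "z \<noteq> 0" using that N by (auto simp: admissible_def M_def)
      have prime: "prime_elem (X v - const z)" using z v by (intro prime_X_minus_const)
      show "\<not> X v - const z dvd C"
      proof
        assume "X v - const z dvd C"
        then obtain w where w: "w \<in> V - {v}" "X v - const z dvd eval_at (X w) (?h w)"
          using prime_elem_dvd_prodE[OF prime, of "V - {v}" "\<lambda>w. eval_at (X w) (?h w)"]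
          unfolding C_def by auto
        then have "unimodular w" "lexpos e w" using N by (auto simp: V_def admissible_def)
        moreover have "?h w \<noteq> 0" by (rule pcompose_monom_nonzero[OF factor_at_nonzero m])
        ultimately have "w = v"
          using coprime_directions[OF e z(1) _ v(1) _ v(2) _ w(2)] by simp
        with w(1) show False by blast
      qed
    qed
    have "?g v = (\<Prod>z\<in>#M. [:- z, 1:])" unfolding factor_at_def M_def ..
    also have "(\<Prod>z\<in>#M. [:- z, 1:]) dvd ?h v"
    proof (rule linear_factors_dvd_eval_at_mult[OF v(1)])
      show "(\<Prod>z\<in>#M. X v - const z) dvd eval_at (X v) (?h v) * C"
        using dvd unfolding eval_at_factor_at[of v N] M_def .
    qed (rule coprime)
    finally show ?thesis .
  qed
qed

lemma factor_at_power_polynomial: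
  fixes N :: "(('n::finite \<Rightarrow>\<^sub>0 int) \<times> complex) multiset"
  assumes "inj e" "admissible e N" "c \<noteq> 0"
    and "F = Poly_Mapping.single t c * binomials N" "\<And>m. m \<ge> 1 \<Longrightarrow> F dvd dilation m F"
  shows "power_polynomial (factor_at N v)"
  unfolding power_polynomial_def using factor_at_dvd_substitute_power[OF assms] by blast

section \<open>Lexicographic term orders and positive fractions\<close>

definition lex_term_order :: "('n \<Rightarrow> nat) \<Rightarrow> 'n exponent rel" where
  "lex_term_order e = {(p, q). p = q \<or> lexpos e (Poly_Mapping.map int q - Poly_Mapping.map int p)}"

text \<open>Listing the exponents by increasing number embeds the order into the well-founded lexicographic order on lists of a
  fixed length; numbers that \<open>e\<close> does not use are filled with \<open>0\<close>.\<close>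

lemma wf_lex_term_order:
  fixes e :: "'n::finite \<Rightarrow> nat"
  assumes e: "inj e"
  shows "wf (lex_term_order e - Id)"
proof -
  obtain d where d: "\<And>j. e j < d"
    using finite_nat_set_iff_bounded[of "range e"] by auto
  define L where "L p = map (\<lambda>i. if i \<in> range e then Poly_Mapping.lookup p (inv e i) else 0) [0..<d]"
    for p :: "'n exponent"
  have nth: "L p ! i = (if i \<in> range e then Poly_Mapping.lookup p (inv e i) else 0)" if "i < d" for p i
    using that by (simp add: L_def)
  have "(L p, L q) \<in> lexn less_than d" if pq: "(p, q) \<in> lex_term_order e - Id" for p q
  proof -
    from pq have "lexpos e (Poly_Mapping.map int q - Poly_Mapping.map int p)"
      by (auto simp: lex_term_order_def)
    then obtain j where j: "Poly_Mapping.lookup p j < Poly_Mapping.lookup q j"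
      "\<And>k. e k < e j \<Longrightarrow> Poly_Mapping.lookup p k = Poly_Mapping.lookup q k"
      unfolding lexpos_def by (auto simp: lookup_minus)
    have len: "length (L p) = d" "length (L q) = d" by (simp_all add: L_def)
    have "take (e j) (L p) = take (e j) (L q)"
    proof (rule nth_equalityI)
      fix i assume "i < length (take (e j) (L p))"
      then have i: "i < e j" "i < d" using len by auto
      show "take (e j) (L p) ! i = take (e j) (L q) ! i"
        using i j(2)[of "inv e i"] e by (auto simp: nth)
    qed (simp add: len)
    moreover have "L p ! e j < L q ! e j" using d[of j] e j(1) by (simp add: nth)
    moreover have "L p = take (e j) (L p) @ L p ! e j # drop (Suc (e j)) (L p)"
      "L q = take (e j) (L q) @ L q ! e j # drop (Suc (e j)) (L q)"
      using d[of j] len by (simp_all add: id_take_nth_drop)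
    ultimately show ?thesis unfolding lexn_conv using len
      by (metis (mono_tags, lifting) case_prodI mem_Collect_eq less_than_iff)
  qed
  then have "lex_term_order e - Id \<subseteq> inv_image (lexn less_than d) L"
    by (auto simp: inv_image_def)
  moreover have "wf (inv_image (lexn less_than d) L)" by (intro wf_inv_image wf_lexn) simp
  ultimately show ?thesis by (rule wf_subset[rotated])
qed

lemma term_order_lex:
  fixes e :: "'n::finite \<Rightarrow> nat"
  assumes e: "inj e"
  shows "term_order (lex_term_order e)"
proof -
  interpret total_group_order "lexpos e" using e by (rule lexpos_order)
  let ?i = "Poly_Mapping.map int :: 'n exponent \<Rightarrow> _"
  have total: "(p, q) \<in> lex_term_order e \<or> (q, p) \<in> lex_term_order e" for p q :: "'n exponent"
    using pos_total[of "?i q - ?i p"] inj_map_int by (auto simp: lex_term_order_def dest: injD)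
  have antisym: "p = q" if "(p, q) \<in> lex_term_order e" "(q, p) \<in> lex_term_order e" for p q :: "'n exponent"
    using that pos_add[of "?i q - ?i p" "?i p - ?i q"] not_pos_0 by (auto simp: lex_term_order_def)
  have trans: "(p, r) \<in> lex_term_order e"
    if "(p, q) \<in> lex_term_order e" "(q, r) \<in> lex_term_order e" for p q r :: "'n exponent"
    using that pos_add[of "?i q - ?i p" "?i r - ?i q"] by (auto simp: lex_term_order_def)
  have "well_order_on UNIV (lex_term_order e)"
    unfolding well_order_on_def linear_order_on_def partial_order_on_def preorder_on_def
    using wf_lex_term_order[OF e] total antisym trans
    by (auto simp: refl_on_def total_on_def intro!: antisymI transI)
  moreover have "(p + s, q + s) \<in> lex_term_order e" if "(p, q) \<in> lex_term_order e" for p q s :: "'n exponent"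
    using that by (auto simp: lex_term_order_def map_int_add)
  moreover have "(0, p) \<in> lex_term_order e" for p :: "'n exponent"
  proof -
    have "\<not> lexpos e (- ?i p)" by (auto simp: lexpos_def not_less)
    then show ?thesis using total[of 0 p] by (auto simp: lex_term_order_def)
  qed
  ultimately show ?thesis by (auto simp: term_order_def)
qed

text \<open>The negative and the positive part of \<open>v\<close> form the primitive pair.\<close>

lemma positive_fraction_X:
  fixes v :: "'n::finite \<Rightarrow>\<^sub>0 int"
  assumes "unimodular v" "lexpos e v"
  shows "positive_fraction (lex_term_order e) (X v)"
proof -
  define p :: "'n exponent" where "p = Poly_Mapping.map (\<lambda>a. nat (- a)) v"
  define q :: "'n exponent" where "q = Poly_Mapping.map nat v"
  have p: "Poly_Mapping.lookup p j = nat (- Poly_Mapping.lookup v j)" for j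
    by (simp add: p_def map.rep_eq when_def)
  have q: "Poly_Mapping.lookup q j = nat (Poly_Mapping.lookup v j)" for j
    by (simp add: q_def map.rep_eq when_def)
  have diff: "Poly_Mapping.map int q - Poly_Mapping.map int p = v"
    by (rule poly_mapping_eqI) (simp add: lookup_minus p q)
  have "Gcd (range (Poly_Mapping.lookup p) \<union> range (Poly_Mapping.lookup q)) = 1" (is "?g = 1")
  proof -
    obtain w where w: "dot w v = 1" using assms(1) by (auto simp: unimodular_def)
    have "int ?g dvd Poly_Mapping.lookup v j" for j
    proof -
      have "int ?g dvd int (Poly_Mapping.lookup q j) - int (Poly_Mapping.lookup p j)"
        by (intro dvd_diff) (auto intro: Gcd_dvd)
      also have "int (Poly_Mapping.lookup q j) - int (Poly_Mapping.lookup p j) = Poly_Mapping.lookup v j"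
        by (simp add: p q)
      finally show ?thesis .
    qed
    then have "int ?g dvd dot w v" unfolding dot_def by (intro dvd_sum dvd_mult)
    then show ?thesis using w by simp
  qed
  moreover have "Poly_Mapping.keys p \<inter> Poly_Mapping.keys q = {}" by (auto simp: in_keys_iff p q)
  ultimately have "primitive_pair p q" by (simp add: primitive_pair_def)
  moreover have "p \<noteq> q" using diff unimodular_nonzero[OF assms(1)] by auto
  ultimately show ?thesis unfolding positive_fraction_def
    using assms(2) by (intro exI[of _ p] exI[of _ q]) (simp add: lex_term_order_def fraction_def diff)
qed

lemma ex_admissible_direction: "\<exists>v :: 'n::finite \<Rightarrow>\<^sub>0 int. unimodular v \<and> lexpos e v"
proof -
  fix j :: 'n
  let ?v = "Poly_Mapping.single j (1::int)"
  have "dot (\<lambda>k. if k = j then 1 else 0) ?v = 1" by (simp add: dot_def if_distrib[of "\<lambda>x. x * _"] cong: if_cong)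
  moreover have "lexpos e ?v" by (auto simp: lexpos_def lookup_single when_def intro!: exI[of _ j])
  ultimately show ?thesis by (auto simp: unimodular_def)
qed

lemma power_polynomial_smult:
  assumes "power_polynomial g" "c \<noteq> 0"
  shows "power_polynomial (smult c g)"
  using assms by (auto simp: power_polynomial_def pcompose_smult smult_dvd_iff dvd_smult_iff)

section \<open>The factorization theorem\<close>

definition fraction_factorization ::
  "'n exponent rel \<Rightarrow> 'n::finite mpoly \<Rightarrow> 'n exponent \<Rightarrow> nat \<Rightarrow> (nat \<Rightarrow> 'n laurent) \<Rightarrow> (nat \<Rightarrow> complex poly) \<Rightarrow> bool" where
  "fraction_factorization T f p k \<xi> g \<longleftrightarrow> term_order T \<and> inj_on \<xi> {1..k} \<and>
     (\<forall>i\<in>{1..k}. positive_fraction T (\<xi> i) \<and> g i \<noteq> 0 \<and> power_polynomial (g i)) \<and>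
     to_laurent f = to_laurent (Poly_Mapping.single p 1) * (\<Prod>i=1..k. eval_at (\<xi> i) (g i))"

text \<open>The constant \<open>c\<close> of the unit \<open>c x^t\<close> has no place in the monomial of the factorization and is absorbed
  into one of the power-polynomials.  For this the set of directions is enlarged by some \<open>v0\<close>, since \<open>f\<close> may be a scalar
  multiple of a monomial.\<close>

lemma power_closed_imp_factorization:
  fixes f :: "'n::finite mpoly"
  assumes "f \<noteq> 0" "\<And>m. m \<ge> 1 \<Longrightarrow> f dvd power_subst m f"
  shows "\<exists>T p k \<xi> g. fraction_factorization T f p k \<xi> g"
proof -
  let ?F = "to_laurent f"
  obtain e :: "'n \<Rightarrow> nat" where e: "inj e" using ex_inj_nat by blast
  have F: "?F dvd dilation m ?F" if "m \<ge> 1" for m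
    using assms dvd_power_subst_iff[of f m] that by blast
  have "?F \<noteq> 0" using assms(1) by (simp add: to_laurent_eq_0_iff)
  with F obtain t c N where N: "c \<noteq> 0" "admissible e N" "?F = Poly_Mapping.single t c * binomials N"
    using power_divisor_factorization[OF e, of ?F] by blast
  have "t \<in> Poly_Mapping.keys ?F"
    unfolding N(3) using e N(2,1) by (rule monomial_in_keys_monomial_mult_binomials)
  then obtain p where p: "t = Poly_Mapping.map int p" using keys_to_laurent[of f] by blast
  obtain v0 :: "'n \<Rightarrow>\<^sub>0 int" where v0: "unimodular v0" "lexpos e v0" using ex_admissible_direction by blast
  define V where "V = insert v0 (fst ` set_mset N)"
  have [simp]: "finite V" by (simp add: V_def)
  have V: "unimodular v" "lexpos e v" if "v \<in> V" for v
    using that v0 N(2) by (auto simp: V_def admissible_def)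
  define G where "G v = (if v = v0 then smult c (factor_at N v) else factor_at N v)" for v
  have power: "power_polynomial (factor_at N v)" for v
    using factor_at_power_polynomial[OF e N(2,1,3) F] .
  have G: "G v \<noteq> 0" "power_polynomial (G v)" for v
    using N(1) power[of v] by (auto simp: G_def factor_at_nonzero power_polynomial_smult)
  have eval_G: "eval_at (X v) (G v) = (if v = v0 then const c else 1) * eval_at (X v) (factor_at N v)" for v
    by (simp add: G_def eval_at_smult)
  have "(\<Prod>v\<in>V. eval_at (X v) (G v)) = (\<Prod>v\<in>V. if v = v0 then const c else 1) * binomials N"
    unfolding eval_G by (subst binomials_group[of V]) (auto simp: prod.distrib V_def)
  also have "(\<Prod>v\<in>V. if v = v0 then const c else (1 :: 'n laurent)) = const c"
    by (simp add: prod.delta) (simp add: V_def)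
  finally have prod: "(\<Prod>v\<in>V. eval_at (X v) (G v)) = const c * binomials N" .
  obtain b where b: "bij_betw b {1..card V} V" using ex_bij_betw_nat_finite_1[of V] by auto
  have "fraction_factorization (lex_term_order e) f p (card V) (\<lambda>i. X (b i)) (\<lambda>i. G (b i))"
    unfolding fraction_factorization_def
  proof (intro conjI ballI)
    show "term_order (lex_term_order e)" using e by (rule term_order_lex)
    show "inj_on (\<lambda>i. X (b i) :: 'n laurent) {1..card V}"
    proof (rule inj_onI)
      fix i j assume "i \<in> {1..card V}" "j \<in> {1..card V}" "X (b i) = (X (b j) :: 'n laurent)"
      moreover from this have "b i = b j" by (metis keys_single one_neq_zero singleton_inject)
      ultimately show "i = j" using b by (auto simp: bij_betw_def dest: inj_onD)
    qed
    show "positive_fraction (lex_term_order e) (X (b i))" if "i \<in> {1..card V}" for i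
      using that b by (intro positive_fraction_X V) (auto simp: bij_betw_def)
    have "(\<Prod>i=1..card V. eval_at (X (b i)) (G (b i))) = const c * binomials N"
      using prod prod.reindex_bij_betw[OF b, of "\<lambda>v. eval_at (X v) (G v)"] by simp
    then show "?F = to_laurent (X p) * (\<Prod>i=1..card V. eval_at (X (b i)) (G (b i)))"
      by (simp add: N(3) p to_laurent_monomial mult_single mult.assoc[symmetric])
  qed (use G in auto)
  then show ?thesis by blast
qed

lemma factorization_imp_power_closed:
  fixes f :: "'n::finite mpoly"
  assumes "f \<noteq> 0" "fraction_factorization T f p k \<xi> g" "m \<ge> 1"
  shows "f dvd power_subst m f"
proof -
  have "\<forall>i\<in>{1..k}. \<exists>u. \<xi> i = X u"
    using assms(2) by (auto simp: fraction_factorization_def positive_fraction_def fraction_def)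
  then obtain u where u: "\<And>i. i \<in> {1..k} \<Longrightarrow> \<xi> i = X (u i)" by metis
  have "to_laurent f = X (Poly_Mapping.map int p) * (\<Prod>i=1..k. eval_at (X (u i)) (g i))"
    using assms(2) u by (simp add: fraction_factorization_def to_laurent_monomial)
  then show ?thesis
    using assms product_dvd_dilation[of m "{1..k}" g "Poly_Mapping.map int p" u]
    by (simp add: dvd_power_subst_iff fraction_factorization_def)
qed

section \<open>Power-polynomials in one variable\<close>

text \<open>For \<open>z \<noteq> 0\<close> the polynomial \<open>x^i - z^i\<close> has a simple zero at \<open>z\<close>, so the multiplicity of \<open>z\<close> in \<open>g(x^i)\<close> equals that
  of \<open>z^i\<close> in \<open>g\<close>.\<close>

lemma order_le_order_power:
  fixes g :: "complex poly"
  assumes g: "g \<noteq> 0" "power_polynomial g" and z: "z \<noteq> 0" and i: "i \<ge> 1"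
  shows "order z g \<le> order (z ^ i) g"
proof -
  define n where "n = order (z ^ i) g"
  obtain q where q: "g = [:- (z ^ i), 1:] ^ n * q" "\<not> [:- (z ^ i), 1:] dvd q"
    using order_decomp[OF g(1), of "z ^ i"] n_def by blast
  define l where "l = monom 1 i - [:z ^ i:]"
  have "poly l z = 0" by (simp add: l_def poly_monom)
  have "poly (pderiv l) z \<noteq> 0"
    using z i by (simp add: l_def pderiv_diff pderiv_monom poly_monom pderiv_pCons)
  then have "pderiv l \<noteq> 0" "order z (pderiv l) = 0" by (auto simp: order_root)
  moreover have "l \<noteq> 0" using \<open>pderiv l \<noteq> 0\<close> by auto
  ultimately have l: "order z l = 1"
    using order_pderiv[of l z] \<open>poly l z = 0\<close> by (simp add: order_root)
  have comp: "pcompose g (monom 1 i) = l ^ n * pcompose q (monom 1 i)"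
  proof -
    have "pcompose [:- (z ^ i), 1:] (monom 1 i) = l"
      by (simp add: pcompose_pCons l_def)
    then show ?thesis
      by (simp add: q(1) pcompose_mult pcompose_power)
  qed
  have "poly (pcompose q (monom 1 i)) z \<noteq> 0"
    using q(2) by (simp add: poly_pcompose poly_monom poly_eq_0_iff_dvd)
  then have "pcompose q (monom 1 i) \<noteq> 0" "order z (pcompose q (monom 1 i)) = 0"
    by (auto simp: order_root)
  then have "order z (pcompose g (monom 1 i)) = n"
  proof -
    have "order z (l ^ n) = n"
      using l \<open>l \<noteq> 0\<close> by (induction n) (simp_all add: order_mult)
    with \<open>l \<noteq> 0\<close> \<open>pcompose q (monom 1 i) \<noteq> 0\<close> \<open>order z (pcompose q (monom 1 i)) = 0\<close>
    show ?thesis by (simp add: comp order_mult)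
  qed
  moreover have "pcompose g (monom 1 i) \<noteq> 0" using g(1) i by (rule pcompose_monom_nonzero)
  moreover have "g dvd pcompose g (monom 1 i)" using g(2) i by (simp add: power_polynomial_def)
  ultimately show ?thesis using dvd_imp_order_le n_def by metis
qed

definition primitive_roots :: "nat \<Rightarrow> complex set" where
  "primitive_roots n = {z. z ^ n = 1 \<and> (\<forall>m. 0 < m \<and> m < n \<longrightarrow> z ^ m \<noteq> 1)}"

lemma cyclotomic_eq: "cyclotomic n = (\<Prod>z\<in>primitive_roots n. [:- z, 1:])"
  by (simp add: cyclotomic_def primitive_roots_def)

lemma primitive_roots_power_eq_1_iff:
  assumes "z \<in> primitive_roots n" "n \<ge> 1"
  shows "z ^ m = 1 \<longleftrightarrow> n dvd m"
proof -
  have "z ^ m = (z ^ n) ^ (m div n) * z ^ (m mod n)"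
    by (metis mult_div_mod_eq power_add power_mult)
  also have "\<dots> = z ^ (m mod n)" using assms by (simp add: primitive_roots_def)
  finally have "z ^ m = z ^ (m mod n)" .
  moreover have "m mod n < n" using assms by simp
  ultimately show ?thesis using assms(1)
    by (auto simp: primitive_roots_def mod_eq_0_iff_dvd[symmetric])
qed

lemma primitive_roots_disjoint:
  assumes "z \<in> primitive_roots m" "z \<in> primitive_roots n" "m \<ge> 1" "n \<ge> 1"
  shows "m = n"
  using assms primitive_roots_power_eq_1_iff by (metis dvd_antisym dvd_refl)

lemma root_of_unity_primitive:
  assumes "z ^ N = 1" "N \<ge> 1"
  obtains n where "n \<ge> 1" "z \<in> primitive_roots n"
proof -
  define n where "n = (LEAST n. n \<ge> 1 \<and> z ^ n = 1)"
  have "n \<ge> 1 \<and> z ^ n = 1" unfolding n_def by (rule LeastI[of _ N]) (use assms in auto)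
  moreover have "z ^ m \<noteq> 1" if "0 < m" "m < n" for m
    using that not_less_Least[of m "\<lambda>n. n \<ge> 1 \<and> z ^ n = 1"] by (auto simp: n_def)
  ultimately show ?thesis using that[of n] by (auto simp: primitive_roots_def)
qed

lemma finite_primitive_roots: "n \<ge> 1 \<Longrightarrow> finite (primitive_roots n)"
  by (rule finite_subset[OF _ finite_roots_unity[of n]]) (auto simp: primitive_roots_def)

text \<open>The first \<open>n\<close> powers of \<open>z\<close> are distinct, and there are only \<open>n\<close> solutions of \<open>w^n = 1\<close>.\<close>

lemma primitive_root_generates:
  assumes z: "z \<in> primitive_roots n" "n \<ge> 1" and w: "w ^ n = 1"
  obtains i where "i \<ge> 1" "w = z ^ i"
proof -
  have z1: "z ^ n = 1" using z by (simp add: primitive_roots_def)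
  then have z0: "z \<noteq> 0" using z by (auto simp: zero_power)
  have "inj_on (\<lambda>i. z ^ i) {..<n}"
  proof (rule linorder_inj_onI)
    fix i j assume ij: "i < j" "i \<in> {..<n}" "j \<in> {..<n}"
    have "z ^ j = z ^ i * z ^ (j - i)" using ij by (simp add: power_add[symmetric])
    moreover have "z ^ (j - i) \<noteq> 1" using ij z(1) by (auto simp: primitive_roots_def)
    ultimately show "z ^ i \<noteq> z ^ j" using z0 by auto
  qed auto
  then have "card ((\<lambda>i. z ^ i) ` {..<n}) = card {w::complex. w ^ n = 1}"
    using z by (simp add: card_image card_roots_unity_eq)
  moreover have "(\<lambda>i. z ^ i) ` {..<n} \<subseteq> {w. w ^ n = 1}"
    using z1 by (auto simp: power_mult[symmetric] mult.commute[of _ n]) (simp add: power_mult)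
  ultimately have "(\<lambda>i. z ^ i) ` {..<n} = {w. w ^ n = 1}"
    using z by (intro card_subset_eq finite_roots_unity) auto
  then obtain i where "w = z ^ i" using w by blast
  (* i may be 0, but a positive exponent is wanted *)
  then have "w = z ^ (i + n)" by (simp add: power_add z1)
  then show ?thesis using z that[of "i + n"] by simp
qed

lemma cis_primitive_root:
  assumes "n \<ge> 1"
  shows "cis (2 * pi / n) \<in> primitive_roots n"
proof -
  have bij: "bij_betw (\<lambda>k. cis (2 * pi * real k / real n)) {..<n} {z. z ^ n = 1}"
    using assms by (intro bij_betw_roots_unity) auto
  have pow: "cis (2 * pi / n) ^ k = cis (2 * pi * real k / real n)" for k
    by (simp add: DeMoivre mult_ac)
  have "cis (2 * pi / n) ^ n = 1" using assms by (simp add: pow)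
  moreover have "cis (2 * pi / n) ^ m \<noteq> 1" if "0 < m" "m < n" for m
  proof
    assume "cis (2 * pi / n) ^ m = 1"
    then have "cis (2 * pi * real m / real n) = cis (2 * pi * real 0 / real n)" unfolding pow by simp
    then have "m = 0"
      using that assms by (intro inj_onD[OF bij_betw_imp_inj_on[OF bij]]) auto
    with that show False by simp
  qed
  ultimately show ?thesis by (auto simp: primitive_roots_def)
qed

locale nonzero_power_polynomial =
  fixes g :: "complex poly"
  assumes g_nonzero: "g \<noteq> 0" and power: "power_polynomial g"
begin

definition cyclotomic_exponent :: "nat \<Rightarrow> nat" where
  "cyclotomic_exponent n = order (cis (2 * pi / n)) g"

text \<open>Any two primitive \<open>n\<close>-th roots of unity are powers of each other, so the inequality for multiplicities applies both ways.\<close>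

lemma order_primitive_root:
  assumes "z \<in> primitive_roots n" "n \<ge> 1"
  shows "order z g = cyclotomic_exponent n"
proof -
  let ?w = "cis (2 * pi / n)"
  have w: "?w \<in> primitive_roots n" using assms(2) by (rule cis_primitive_root)
  have one: "z ^ n = 1" "?w ^ n = 1" using assms(1) w by (simp_all add: primitive_roots_def)
  then have nz: "z \<noteq> 0" "?w \<noteq> 0" using assms(2) by (auto simp: zero_power)
  obtain i where i: "i \<ge> 1" "?w = z ^ i" by (rule primitive_root_generates[OF assms one(2)])
  obtain j where j: "j \<ge> 1" "z = ?w ^ j" by (rule primitive_root_generates[OF w assms(2) one(1)])
  have "order z g \<le> order ?w g"
    unfolding i(2) by (rule order_le_order_power[OF g_nonzero power nz(1) i(1)])
  moreover have "order ?w g \<le> order z g"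
    unfolding j(2) by (rule order_le_order_power[OF g_nonzero power nz(2) j(1)])
  ultimately show ?thesis unfolding cyclotomic_exponent_def by (rule antisym)
qed

text \<open>For \<open>n = m k\<close> the \<open>k\<close>-th power of a primitive \<open>n\<close>-th root of unity is a primitive \<open>m\<close>-th one.\<close>

lemma cyclotomic_exponent_antimono:
  assumes "m \<ge> 1" "n \<ge> 1" "m dvd n"
  shows "cyclotomic_exponent n \<le> cyclotomic_exponent m"
proof -
  obtain k where k: "n = m * k" using assms(3) by (rule dvdE)
  then have "cis (2 * pi / n) ^ k = cis (2 * pi / m)"
    using assms by (simp add: DeMoivre)
  then show ?thesis unfolding cyclotomic_exponent_def
    using order_le_order_power[OF g_nonzero power, of "cis (2 * pi / n)" k] k assms(2) by simp
qed

text \<open>All powers of \<open>z\<close> are among the finitely many roots of \<open>g\<close>, so two of them coincide.\<close>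

lemma nonzero_root_is_root_of_unity:
  assumes "poly g z = 0" "z \<noteq> 0"
  obtains n where "n \<ge> 1" "z \<in> primitive_roots n"
proof -
  have "poly g (z ^ i) = 0" if "i \<ge> 1" for i
    using order_le_order_power[OF g_nonzero power assms(2) that] assms(1) g_nonzero
    by (metis order_root le_zero_eq)
  then have "(\<lambda>i. z ^ i) ` {1..} \<subseteq> {z. poly g z = 0}" by auto
  then have "finite ((\<lambda>i. z ^ i) ` {1..})"
    using poly_roots_finite[OF g_nonzero] by (rule finite_subset)
  then have "\<not> inj_on (\<lambda>i. z ^ i) {1..}"
    using finite_imageD infinite_Ici by blast
  then obtain i j where ij: "i < j" "z ^ i = z ^ j"
    unfolding inj_on_def by (metis linorder_neqE_nat)
  have "z ^ i * z ^ (j - i) = z ^ j" using ij(1) by (simp add: power_add[symmetric])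
  then have "z ^ i * z ^ (j - i) = z ^ i * 1" using ij(2) by simp
  then have "z ^ (j - i) = 1" using assms(2) by simp
  then show ?thesis using ij that by (elim root_of_unity_primitive) auto
qed

definition cyclotomic_support :: "nat set" where
  "cyclotomic_support = {n. n \<ge> 1 \<and> cyclotomic_exponent n \<noteq> 0}"

lemma finite_cyclotomic_support: "finite cyclotomic_support"
proof (rule inj_on_finite[of "\<lambda>n. cis (2 * pi / real n)"])
  show "inj_on (\<lambda>n. cis (2 * pi / real n)) cyclotomic_support"
  proof (rule inj_onI)
    fix m n assume "m \<in> cyclotomic_support" "n \<in> cyclotomic_support"
      and eq: "cis (2 * pi / real m) = cis (2 * pi / real n)"
    then have "m \<ge> 1" "n \<ge> 1" by (simp_all add: cyclotomic_support_def)
    then show "m = n"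
      using primitive_roots_disjoint[OF cis_primitive_root[of m] cis_primitive_root[of n, folded eq]] by blast
  qed
  show "(\<lambda>n. cis (2 * pi / real n)) ` cyclotomic_support \<subseteq> {z. poly g z = 0}"
    by (auto simp: cyclotomic_support_def cyclotomic_exponent_def order_root)
qed (rule poly_roots_finite[OF g_nonzero])

text \<open>The factor \<open>x^k\<close> comes from the root \<open>0\<close>; together with the leading coefficient it is a unit of the ring of
  Laurent polynomials.\<close>

lemma cyclotomic_factorization:
  "g = smult (lead_coeff g) (monom 1 (order 0 g) * (\<Prod>n\<in>cyclotomic_support. cyclotomic n ^ cyclotomic_exponent n))"
proof -
  let ?l = "\<lambda>z. [:- z, 1:] ^ order z g"
  let ?R = "\<Union>n\<in>cyclotomic_support. primitive_roots n"
  have R: "{z. poly g z = 0} - {0} = ?R"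
  proof (intro set_eqI iffI)
    fix z assume "z \<in> {z. poly g z = 0} - {0}"
    then have z: "poly g z = 0" "z \<noteq> 0" by auto
    then obtain n where n: "n \<ge> 1" "z \<in> primitive_roots n" by (rule nonzero_root_is_root_of_unity)
    with z g_nonzero have "cyclotomic_exponent n \<noteq> 0" by (metis order_primitive_root order_root)
    with n show "z \<in> ?R" by (auto simp: cyclotomic_support_def)
  next
    fix z assume "z \<in> ?R"
    then obtain n where n: "n \<ge> 1" "cyclotomic_exponent n \<noteq> 0" "z \<in> primitive_roots n"
      by (auto simp: cyclotomic_support_def)
    then have "poly g z = 0" by (metis order_primitive_root order_root)
    moreover have "z \<noteq> 0" using n by (auto simp: primitive_roots_def zero_power)
    ultimately show "z \<in> {z. poly g z = 0} - {0}" by simp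
  qed
  have fin: "finite {z. poly g z = 0}" by (rule poly_roots_finite[OF g_nonzero])
  have "(\<Prod>z | poly g z = 0. ?l z) = ?l 0 * (\<Prod>z\<in>{z. poly g z = 0} - {0}. ?l z)"
  proof (cases "poly g 0 = 0")
    case True
    with fin show ?thesis by (intro prod.remove) auto
  next
    case False
    then have "{z. poly g z = 0} - {0} = {z. poly g z = 0}" "order 0 g = 0" by (auto simp: order_root)
    then show ?thesis by simp
  qed
  also have "(\<Prod>z\<in>{z. poly g z = 0} - {0}. ?l z) = (\<Prod>n\<in>cyclotomic_support. \<Prod>z\<in>primitive_roots n. ?l z)"
    unfolding R
  proof (rule prod.UNION_disjoint[OF finite_cyclotomic_support])
    show "\<forall>n\<in>cyclotomic_support. finite (primitive_roots n)"
      by (simp add: cyclotomic_support_def finite_primitive_roots)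
    show "\<forall>m\<in>cyclotomic_support. \<forall>n\<in>cyclotomic_support. m \<noteq> n \<longrightarrow> primitive_roots m \<inter> primitive_roots n = {}"
      unfolding cyclotomic_support_def using primitive_roots_disjoint by blast
  qed
  also have "\<dots> = (\<Prod>n\<in>cyclotomic_support. cyclotomic n ^ cyclotomic_exponent n)"
    by (intro prod.cong refl)
       (simp add: cyclotomic_eq prod_power_distrib cyclotomic_support_def order_primitive_root)
  also have "?l 0 = monom 1 (order 0 g)" by (simp add: monom_altdef)
  finally have product: "(\<Prod>z | poly g z = 0. ?l z)
    = monom 1 (order 0 g) * (\<Prod>n\<in>cyclotomic_support. cyclotomic n ^ cyclotomic_exponent n)" .
  show ?thesis using complex_poly_decompose[of g] unfolding product by (rule sym)
qed

lemma laurent_associated_cyclotomic_product: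
  "laurent_associated g (\<Prod>n\<in>cyclotomic_support. cyclotomic n ^ cyclotomic_exponent n)"
proof -
  let ?\<Phi> = "\<Prod>n\<in>cyclotomic_support. cyclotomic n ^ cyclotomic_exponent n"
  define u :: laurent1 where "u = Poly_Mapping.single (\<Sum>k<order 0 g. 1) (lead_coeff g)"
  have "u dvd 1" unfolding u_def using g_nonzero by (intro monomial_dvd_1) simp
  moreover have "to_laurent1 g = u * to_laurent1 ?\<Phi>"
  proof -
    have "to_laurent1 g = const (lead_coeff g) * (X 1 ^ order 0 g * to_laurent1 ?\<Phi>)"
      unfolding to_laurent1_def
      by (subst cyclotomic_factorization) (simp add: eval_at_smult eval_at_mult eval_at_monom)
    then show ?thesis by (simp add: X_power u_def mult_single mult.assoc[symmetric])
  qed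
  ultimately show ?thesis unfolding laurent_associated_def by blast
qed

end

section \<open>Psi-polynomials\<close>

lemma distinct_linear_factors_dvd:
  fixes q :: "complex poly"
  assumes "finite Z" "\<And>z. z \<in> Z \<Longrightarrow> poly q z = 0"
  shows "(\<Prod>z\<in>Z. [:- z, 1:]) dvd q"
  using assms
proof (induction Z arbitrary: q rule: finite_induct)
  case (insert z Z)
  then have "poly q z = 0" by simp
  then obtain h where h: "q = [:- z, 1:] * h" by (auto simp: poly_eq_0_iff_dvd elim: dvdE)
  have "poly h y = 0" if "y \<in> Z" for y
    using insert.prems[of y] insert.hyps that unfolding h by auto
  then have "(\<Prod>z\<in>Z. [:- z, 1:]) dvd h" by (rule insert.IH)
  then have "[:- z, 1:] * (\<Prod>z\<in>Z. [:- z, 1:]) dvd [:- z, 1:] * h" by (rule mult_dvd_mono[OF dvd_refl])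
  then show ?case unfolding h using insert.hyps by (simp del: mult_pCons_left)
qed simp

text \<open>Both sides are the monic squarefree polynomial whose roots are the solutions of \<open>z^a = 1\<close> for some
  \<open>a \<in> A\<close>: the order of such a \<open>z\<close> divides \<open>a\<close>.\<close>

lemma psi_eq_cyclotomic_product:
  assumes "finite A" "0 \<notin> A"
  shows "psi A = (\<Prod>n | \<exists>a\<in>A. n dvd a. cyclotomic n)"
proof -
  let ?D = "{n. \<exists>a\<in>A. n dvd a}"
  define Z where "Z = {z::complex. \<exists>a\<in>A. z ^ a = 1}"
  define P where "P = (\<Prod>z\<in>Z. [:- z, 1:])"
  have Z_UN: "Z = (\<Union>a\<in>A. {z. z ^ a = 1})" by (auto simp: Z_def)
  have finZ: "finite Z" unfolding Z_UN using assms by (intro finite_UN_I finite_roots_unity) (auto simp: Suc_le_eq intro: gr0I)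
  have D1: "n \<ge> 1" if "n \<in> ?D" for n using that assms(2) by (auto simp: Suc_le_eq intro: gr0I)
  have finD: "finite ?D"
  proof -
    have "?D = (\<Union>a\<in>A. {n. n dvd a})" by auto
    then show ?thesis using assms by (auto intro!: finite_divisors_nat intro: gr0I)
  qed
  have Z_D: "Z = (\<Union>n\<in>?D. primitive_roots n)"
  proof (intro set_eqI iffI)
    fix z assume "z \<in> Z"
    then obtain a where a: "a \<in> A" "z ^ a = 1" by (auto simp: Z_def)
    then have "a \<ge> 1" using assms(2) by (cases a) auto
    with a(2) obtain n where "n \<ge> 1" "z \<in> primitive_roots n" by (rule root_of_unity_primitive)
    moreover from this have "n dvd a" using a(2) primitive_roots_power_eq_1_iff by simp
    ultimately show "z \<in> (\<Union>n\<in>?D. primitive_roots n)" using a(1) by auto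
  next
    fix z assume "z \<in> (\<Union>n\<in>?D. primitive_roots n)"
    then obtain n a where "n \<in> ?D" "a \<in> A" "n dvd a" "z \<in> primitive_roots n" by blast
    moreover from this have "z ^ a = 1" using D1 primitive_roots_power_eq_1_iff by simp
    ultimately show "z \<in> Z" unfolding Z_def by blast
  qed
  have "P = (\<Prod>n\<in>?D. cyclotomic n)"
    unfolding P_def Z_D cyclotomic_eq
  proof (rule prod.UNION_disjoint[OF finD])
    show "\<forall>n\<in>?D. finite (primitive_roots n)" using D1 finite_primitive_roots by simp
    show "\<forall>m\<in>?D. \<forall>n\<in>?D. m \<noteq> n \<longrightarrow> primitive_roots m \<inter> primitive_roots n = {}"
    proof (intro ballI impI)
      fix m n assume "m \<in> ?D" "n \<in> ?D" "m \<noteq> n"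
      then show "primitive_roots m \<inter> primitive_roots n = {}"
        using primitive_roots_disjoint[of _ m n] D1[of m] D1[of n] by blast
    qed
  qed
  moreover have "psi A = P"
  proof (rule associated_eqI)
    show "psi A dvd P"
      unfolding psi_def
    proof (rule Lcm_least)
      fix b assume "b \<in> (\<lambda>a. monom 1 a - 1 :: complex poly) ` A"
      then obtain a where a: "a \<in> A" "b = monom 1 a - 1" by blast
      have "a \<noteq> 0" using a(1) assms(2) by metis
      have root: "poly b z = z ^ a - 1" for z by (simp add: a poly_monom)
      have "b \<noteq> 0" using root[of 0] \<open>a \<noteq> 0\<close> by (auto simp: zero_power)
      have "rsquarefree b"
        unfolding rsquarefree_roots
      proof (intro allI notI)
        fix z assume z: "poly b z = 0 \<and> poly (pderiv b) z = 0"
        then have "z ^ a = 1" by (simp add: root)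
        then have "z \<noteq> 0" using \<open>a \<noteq> 0\<close> by (auto simp: zero_power)
        with z \<open>a \<noteq> 0\<close> show False by (simp add: a pderiv_diff pderiv_monom poly_monom)
      qed
      then have "b = smult (lead_coeff b) (\<Prod>z | poly b z = 0. [:- z, 1:])"
        by (rule complex_poly_decompose_rsquarefree[symmetric])
      moreover have "(\<Prod>z | poly b z = 0. [:- z, 1:]) dvd P"
        unfolding P_def using finZ a(1) by (intro prod_dvd_prod_subset) (auto simp: root Z_def)
      ultimately show "b dvd P" using \<open>b \<noteq> 0\<close> by (metis leading_coeff_0_iff smult_dvd)
    qed
    show "P dvd psi A"
      unfolding P_def
    proof (rule distinct_linear_factors_dvd[OF finZ])
      fix z assume "z \<in> Z"
      then obtain a where a: "a \<in> A" "z ^ a = 1" by (auto simp: Z_def)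
      then have "monom 1 a - 1 dvd psi A" unfolding psi_def by (intro dvd_Lcm) auto
      moreover have "poly (monom 1 a - 1) z = 0" using a(2) by (simp add: poly_monom)
      ultimately show "poly (psi A) z = 0" by (metis dvd_trans poly_eq_0_iff_dvd)
    qed
    show "normalize (psi A) = psi A" by (simp add: psi_def)
    have "lead_coeff P = 1" by (simp add: P_def lead_coeff_prod)
    then show "normalize P = P" by (simp add: normalize_poly_def one_pCons[symmetric])
  qed
  ultimately show ?thesis by simp
qed

context nonzero_power_polynomial
begin

definition layer :: "nat \<Rightarrow> nat set" where
  "layer j = {n. n \<ge> 1 \<and> cyclotomic_exponent n \<ge> j}"

text \<open>A layer is closed under divisors, so it consists of the divisors of its maximal elements; these form the
  antichain of the \<open>j\<close>-th psi-polynomial.\<close>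

definition layer_tops :: "nat \<Rightarrow> nat set" where
  "layer_tops j = {n \<in> layer j. \<forall>m\<in>layer j. n dvd m \<longrightarrow> m = n}"

lemma finite_layer: "j \<ge> 1 \<Longrightarrow> finite (layer j)"
  by (rule finite_subset[OF _ finite_cyclotomic_support]) (auto simp: layer_def cyclotomic_support_def)

lemma finite_layer_tops: "j \<ge> 1 \<Longrightarrow> finite (layer_tops j)"
  using finite_layer by (simp add: layer_tops_def)

lemma layer_tops_antichain: "divisibility_antichain (layer_tops j)"
  by (auto simp: divisibility_antichain_def layer_tops_def layer_def)

lemma psi_layer_tops:
  assumes "j \<ge> 1"
  shows "psi (layer_tops j) = (\<Prod>n\<in>layer j. cyclotomic n)"
proof -
  have "{n. \<exists>a\<in>layer_tops j. n dvd a} = layer j"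
  proof (intro set_eqI iffI)
    fix n assume "n \<in> {n. \<exists>a\<in>layer_tops j. n dvd a}"
    then obtain a where a: "a \<in> layer j" "n dvd a" by (auto simp: layer_tops_def)
    then have "n \<ge> 1" by (cases n) (auto simp: layer_def)
    with a show "n \<in> layer j" using cyclotomic_exponent_antimono[of n a] by (auto simp: layer_def)
  next
    fix n assume n: "n \<in> layer j"
    let ?M = "{m \<in> layer j. n dvd m}"
    have M: "finite ?M" "?M \<noteq> {}" using finite_layer[OF assms] n by auto
    have "Max ?M \<in> ?M" using M by (rule Max_in)
    moreover have "m = Max ?M" if "m \<in> layer j" "Max ?M dvd m" for m
    proof (rule antisym)
      show "m \<le> Max ?M" using M(1) that \<open>Max ?M \<in> ?M\<close> by (intro Max_ge) (auto intro: dvd_trans)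
      show "Max ?M \<le> m" using that by (intro dvd_imp_le) (auto simp: layer_def)
    qed
    ultimately show "n \<in> {n. \<exists>a\<in>layer_tops j. n dvd a}" by (auto simp: layer_tops_def)
  qed
  then show ?thesis
    using psi_eq_cyclotomic_product[OF finite_layer_tops[OF assms]] layer_tops_antichain[of j]
    by (simp add: divisibility_antichain_def)
qed

text \<open>The index \<open>n\<close> lies in the layers \<open>j\<close> with \<open>1 \<le> j \<le> cyclotomic_exponent n\<close>.  No layer beyond \<open>cyclotomic_exponent 1\<close> is inhabited,
  as \<open>1\<close> divides every \<open>n\<close>.\<close>

lemma psi_product:
  "(\<Prod>j=1..cyclotomic_exponent 1. psi (layer_tops j))
    = (\<Prod>n\<in>cyclotomic_support. cyclotomic n ^ cyclotomic_exponent n)"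
proof -
  let ?r = "cyclotomic_exponent 1"
  have "(\<Prod>j=1..?r. psi (layer_tops j))
      = (\<Prod>j=1..?r. \<Prod>n\<in>cyclotomic_support. if j \<le> cyclotomic_exponent n then cyclotomic n else 1)"
  proof (rule prod.cong)
    fix j assume j: "j \<in> {1..?r}"
    then have "layer j = {n \<in> cyclotomic_support. j \<le> cyclotomic_exponent n}"
      by (auto simp: layer_def cyclotomic_support_def)
    then show "psi (layer_tops j)
      = (\<Prod>n\<in>cyclotomic_support. if j \<le> cyclotomic_exponent n then cyclotomic n else 1)"
      using j by (simp add: psi_layer_tops prod.inter_filter finite_cyclotomic_support)
  qed simp
  also have "\<dots> = (\<Prod>n\<in>cyclotomic_support. \<Prod>j=1..?r. if j \<le> cyclotomic_exponent n then cyclotomic n else 1)"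
    by (rule prod.swap)
  also have "\<dots> = (\<Prod>n\<in>cyclotomic_support. cyclotomic n ^ cyclotomic_exponent n)"
  proof (rule prod.cong)
    fix n assume "n \<in> cyclotomic_support"
    then have "cyclotomic_exponent n \<le> ?r"
      using cyclotomic_exponent_antimono[of 1 n] by (simp add: cyclotomic_support_def)
    then have "{j \<in> {1..?r}. j \<le> cyclotomic_exponent n} = {1..cyclotomic_exponent n}" by auto
    then show "(\<Prod>j=1..?r. if j \<le> cyclotomic_exponent n then cyclotomic n else 1)
      = cyclotomic n ^ cyclotomic_exponent n"
      by (simp add: prod.inter_filter[symmetric])
  qed simp
  finally show ?thesis .
qed

end

theorem corollary6p8:
  fixes f :: "'n::finite mpoly"
  assumes "f \<noteq> 0"
  shows "(power_closed_ideal (principal_ideal f) \<longleftrightarrow>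
           (\<exists>(T :: 'n exponent rel) (p :: 'n exponent) (k :: nat)
              (\<xi> :: nat \<Rightarrow> 'n laurent) (g :: nat \<Rightarrow> complex poly).
              term_order T \<and> inj_on \<xi> {1..k} \<and>
              (\<forall>i\<in>{1..k}. positive_fraction T (\<xi> i) \<and> g i \<noteq> 0 \<and> power_polynomial (g i)) \<and>
              to_laurent f =
                to_laurent (Poly_Mapping.single p 1) * (\<Prod>i=1..k. eval_at (\<xi> i) (g i))))
       \<and> (\<forall>g. g \<noteq> 0 \<and> power_polynomial g \<longrightarrow>
            (\<exists>a :: nat \<Rightarrow> nat. finite {n. n \<ge> 1 \<and> a n \<noteq> 0} \<and>
               (\<forall>m\<ge>1. \<forall>n\<ge>1. m dvd n \<longrightarrow> a m \<ge> a n) \<and>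
               laurent_associated g (\<Prod>n | n \<ge> 1 \<and> a n \<noteq> 0. cyclotomic n ^ a n)) \<and>
            (\<exists>(r :: nat) (A :: nat \<Rightarrow> nat set).
               (\<forall>j\<in>{1..r}. finite (A j) \<and> divisibility_antichain (A j)) \<and>
               laurent_associated g (\<Prod>j=1..r. psi (A j))))"
proof (intro conjI allI impI)
  have "power_closed_ideal (principal_ideal f) \<longleftrightarrow> (\<exists>T p k \<xi> g. fraction_factorization T f p k \<xi> g)"
    unfolding power_closed_principal_ideal_iff
    using power_closed_imp_factorization[OF assms] factorization_imp_power_closed[OF assms] by metis
  then show "power_closed_ideal (principal_ideal f) \<longleftrightarrow>
           (\<exists>(T :: 'n exponent rel) (p :: 'n exponent) (k :: nat)
              (\<xi> :: nat \<Rightarrow> 'n laurent) (g :: nat \<Rightarrow> complex poly).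
              term_order T \<and> inj_on \<xi> {1..k} \<and>
              (\<forall>i\<in>{1..k}. positive_fraction T (\<xi> i) \<and> g i \<noteq> 0 \<and> power_polynomial (g i)) \<and>
              to_laurent f =
                to_laurent (Poly_Mapping.single p 1) * (\<Prod>i=1..k. eval_at (\<xi> i) (g i)))"
    unfolding fraction_factorization_def .
next
  fix g :: "complex poly"
  assume "g \<noteq> 0 \<and> power_polynomial g"
  then interpret nonzero_power_polynomial g by unfold_locales auto
  show "\<exists>a :: nat \<Rightarrow> nat. finite {n. n \<ge> 1 \<and> a n \<noteq> 0} \<and>
      (\<forall>m\<ge>1. \<forall>n\<ge>1. m dvd n \<longrightarrow> a m \<ge> a n) \<and>
      laurent_associated g (\<Prod>n | n \<ge> 1 \<and> a n \<noteq> 0. cyclotomic n ^ a n)"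
    using finite_cyclotomic_support cyclotomic_exponent_antimono laurent_associated_cyclotomic_product
    unfolding cyclotomic_support_def by blast
  show "\<exists>(r :: nat) (A :: nat \<Rightarrow> nat set).
      (\<forall>j\<in>{1..r}. finite (A j) \<and> divisibility_antichain (A j)) \<and>
      laurent_associated g (\<Prod>j=1..r. psi (A j))"
  proof (intro exI[of _ "cyclotomic_exponent 1"] exI[of _ layer_tops] conjI ballI)
    fix j assume "j \<in> {1..cyclotomic_exponent 1}"
    then show "finite (layer_tops j)" by (intro finite_layer_tops) simp
    show "divisibility_antichain (layer_tops j)" by (rule layer_tops_antichain)
  next
    show "laurent_associated g (\<Prod>j=1..cyclotomic_exponent 1. psi (layer_tops j))"
      unfolding psi_product by (rule laurent_associated_cyclotomic_product)
  qed
qed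

end
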